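(* Let $\Omega$ be the open unit disk of $\mathbb{R}^2$, let $\sigma_1,\sigma_2>0$ be constants with $\sigma_1\neq\sigma_2$, and let $f(\theta)=\cos\theta$ on $\partial\Omega=S^1$. Let $D_1$ be a disk centered at the origin, of radius $R_1\in(0,1)$. If $D_2$ is an arbitrary disk compactly contained in $\Omega$ and $$\Lambda_{D_1}(f)=\Lambda_{D_2}(f),$$ then $D_1=D_2$.
   Context: For an open connected set $D$ compactly contained in $\Omega$, and $f\in \mathrm{H}^{1/2}(\partial\Omega)$, let $u\in \mathrm{H}^1(\Omega)$ be the unique weak solution of $$\mathrm{div}\big((\sigma_1+(\sigma_2-\sigma_1)\chi_D)\nabla u\big)=0\ \text{ in }\Omega,\qquad u=f\ \text{ on }\partial\Omega,$$ where $\chi_D$ is the characteristic function of $D$. The Dirichlet-to-Neumann map $\Lambda_D:\mathrm{H}^{1/2}(\partial\Omega)\to \mathrm{H}^{-1/2}(\partial\Omega)$ is $\Lambda_D(f)=\sigma_1\,\partial_n u|_{\partial\Omega}$, with $n$ the outward unit normal to $\partial\Omega$. Points of $\partial\Omega$ are written $e^{i\theta}$ and functions on $\partial\Omega$ are viewed as $2\pi$-periodic functions of $\theta$. Disks are open with positive radius. *)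

theory Defs
  imports "HOL-Analysis.Analysis"
begin

text \<open>
  The plane is the type complex with its Euclidean structure (x \<bullet> y is the real scalar
  product), so that the point of angle t on the unit circle is cis t.
  Functions on the circle are 2 pi-periodic functions of t.
\<close>

abbreviation unit_disk :: "complex set" ("\<Omega>") where
  "\<Omega> \<equiv> ball 0 1"

text \<open>Square-integrable functions; as usual, they stand for their classes modulo null sets.\<close>

definition L2 :: "'a measure \<Rightarrow> ('a \<Rightarrow> 'b::real_normed_vector) set" where
  "L2 M = {f \<in> borel_measurable M. integrable M (\<lambda>x. (norm (f x))\<^sup>2)}"

definition L2_circle :: "(real \<Rightarrow> real) set" where
  "L2_circle = {g. (\<forall>t. g (t + 2 * pi) = g t) \<and> g \<in> L2 (lebesgue_on {0..2*pi})}"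

definition tendsto_L2 :: "'a measure \<Rightarrow> (nat \<Rightarrow> 'a \<Rightarrow> 'b::real_normed_vector) \<Rightarrow> ('a \<Rightarrow> 'b) \<Rightarrow> bool"
  where
  "tendsto_L2 M F f \<longleftrightarrow>
     (\<lambda>n. \<integral>x. (norm (F n x - f x))\<^sup>2 \<partial>M) \<longlonglongrightarrow> 0"

definition C1_with_gradient :: "(complex \<Rightarrow> real) \<Rightarrow> (complex \<Rightarrow> complex) \<Rightarrow> bool" where
  "C1_with_gradient \<phi> \<Phi> \<longleftrightarrow> (\<forall>x. GDERIV \<phi> x :> \<Phi> x) \<and> continuous_on UNIV \<Phi>"

text \<open>
  Weak gradients in \<Omega>, tested with continuously differentiable functions of compact support
  in \<Omega>. By mollification, infinitely differentiable test functions give the same notion.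
\<close>

definition has_weak_gradient :: "(complex \<Rightarrow> real) \<Rightarrow> (complex \<Rightarrow> complex) \<Rightarrow> bool" where
  "has_weak_gradient u G \<longleftrightarrow>
     (\<forall>\<phi> \<Phi>. C1_with_gradient \<phi> \<Phi> \<longrightarrow>
        compact (closure {x. \<phi> x \<noteq> 0}) \<longrightarrow> closure {x. \<phi> x \<noteq> 0} \<subseteq> \<Omega> \<longrightarrow>
        (\<integral>x. u x *\<^sub>R \<Phi> x \<partial>lebesgue_on \<Omega>) =
          - (\<integral>x. \<phi> x *\<^sub>R G x \<partial>lebesgue_on \<Omega>))"

definition H1 :: "(complex \<Rightarrow> real) set" where
  "H1 = {u \<in> L2 (lebesgue_on \<Omega>). \<exists>G \<in> L2 (lebesgue_on \<Omega>). has_weak_gradient u G}"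

text \<open>The weak gradient is determined only up to null sets; grad u is one representative.\<close>

definition grad :: "(complex \<Rightarrow> real) \<Rightarrow> complex \<Rightarrow> complex" where
  "grad u = (SOME G. G \<in> L2 (lebesgue_on \<Omega>) \<and> has_weak_gradient u G)"

text \<open>
  The graph of the trace operator from H1 to L2 of the circle, i.e. of the continuous extension
  of restriction to the circle, defined on functions that are continuously differentiable up to
  the boundary. These are dense in H1.
\<close>

definition has_trace :: "(complex \<Rightarrow> real) \<Rightarrow> (real \<Rightarrow> real) \<Rightarrow> bool" where
  "has_trace u g \<longleftrightarrow> u \<in> H1 \<and> g \<in> L2_circle \<and>
     (\<exists>\<phi> \<Phi>. (\<forall>n. C1_with_gradient (\<phi> n) (\<Phi> n)) \<and>
        tendsto_L2 (lebesgue_on \<Omega>) \<phi> u \<and>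
        tendsto_L2 (lebesgue_on \<Omega>) \<Phi> (grad u) \<and>
        tendsto_L2 (lebesgue_on {0..2*pi}) (\<lambda>n t. \<phi> n (cis t)) g)"

text \<open>The fractional space of order 1/2 on the circle is the range of the trace operator.\<close>

definition H_half :: "(real \<Rightarrow> real) set" where
  "H_half = {g. \<exists>v. has_trace v g}"

definition H1_0 :: "(complex \<Rightarrow> real) set" where
  "H1_0 = {v. has_trace v (\<lambda>t. 0)}"

definition conductivity :: "real \<Rightarrow> real \<Rightarrow> complex set \<Rightarrow> complex \<Rightarrow> real" where
  "conductivity \<sigma>\<^sub>1 \<sigma>\<^sub>2 D x = \<sigma>\<^sub>1 + (\<sigma>\<^sub>2 - \<sigma>\<^sub>1) * indicat_real D x"

definition energy :: "real \<Rightarrow> real \<Rightarrow> complex set \<Rightarrow> (complex \<Rightarrow> real) \<Rightarrow> (complex \<Rightarrow> real) \<Rightarrow> real" where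
  "energy \<sigma>\<^sub>1 \<sigma>\<^sub>2 D u v =
     (\<integral>x. conductivity \<sigma>\<^sub>1 \<sigma>\<^sub>2 D x * (grad u x \<bullet> grad v x) \<partial>lebesgue_on \<Omega>)"

definition weak_solution ::
    "real \<Rightarrow> real \<Rightarrow> complex set \<Rightarrow> (real \<Rightarrow> real) \<Rightarrow> (complex \<Rightarrow> real) \<Rightarrow> bool" where
  "weak_solution \<sigma>\<^sub>1 \<sigma>\<^sub>2 D f u \<longleftrightarrow>
     u \<in> H1 \<and> has_trace u f \<and> (\<forall>v \<in> H1_0. energy \<sigma>\<^sub>1 \<sigma>\<^sub>2 D u v = 0)"

text \<open>
  The conormal derivative of a weak solution u, as an element of the dual of H_half:
  by Green's formula the normal derivative of u times the conductivity (which is constant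
  near the circle, D being compactly contained in \<Omega>) pairs with g to the energy of u and v,
  for any v in H1 with trace g. The choice of v does not matter, since the energy of u
  against H1_0 vanishes.
\<close>

definition conormal_derivative ::
    "real \<Rightarrow> real \<Rightarrow> complex set \<Rightarrow> (complex \<Rightarrow> real) \<Rightarrow> (real \<Rightarrow> real) \<Rightarrow> real" where
  "conormal_derivative \<sigma>\<^sub>1 \<sigma>\<^sub>2 D u =
     (\<lambda>g\<in>H_half. energy \<sigma>\<^sub>1 \<sigma>\<^sub>2 D u (SOME v. has_trace v g))"

text \<open>
  The Dirichlet-to-Neumann map as a partial function. For positive conductivities and f in
  H_half the boundary value problem is well posed, so the value is then never None; it does not
  depend on the representative u of the solution.
\<close>

definition DtN ::
    "real \<Rightarrow> real \<Rightarrow> complex set \<Rightarrow> (real \<Rightarrow> real) \<rightharpoonup> ((real \<Rightarrow> real) \<Rightarrow> real)" where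
  "DtN \<sigma>\<^sub>1 \<sigma>\<^sub>2 D f =
     (if \<exists>u. weak_solution \<sigma>\<^sub>1 \<sigma>\<^sub>2 D f u
      then Some (conormal_derivative \<sigma>\<^sub>1 \<sigma>\<^sub>2 D (SOME u. weak_solution \<sigma>\<^sub>1 \<sigma>\<^sub>2 D f u))
      else None)"

end

(*
  With kappa = (sigma_1 - sigma_2) / (sigma_1 + sigma_2) and w = z - c, the function equal to
  Re (alpha w^n) + kappa r^(2n) Re (alpha / cnj w^n) outside the disk of centre c and radius r, and to
  (1 + kappa) Re (alpha w^n) inside it, solves the conductivity equation for that disk: sigma times
  its gradient is the rotated gradient of an explicit continuous stream function. For c = 0 and n = 1
  it gives the solution for D_1 with data cos, whose flux is mu cos with mu different from 1.
  By symmetry of the energy, Lambda_{D_1} cos = Lambda_{D_2} cos forces the flux of each such function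
  for D_2 to have the same pairing with cos as mu times its trace. These pairings are read off from the
  derivative at 0 of holomorphic functions; n = 1 gives the radius and n = 2 gives c = 0.
*)

theory Submission
  imports Defs "HOL-Complex_Analysis.Complex_Analysis"
begin

text \<open>The potentials have a kink along the circle that bounds the disk, while traces and weak
  gradients are reached only through functions that are C1 on the whole plane. Splitting the unit
  disk along that circle would call for a divergence theorem on each piece and for transmission
  conditions. The stream function removes the interface: it belongs to the same family, with
  \<open>- \<kappa>\<close> for \<open>\<kappa>\<close> and \<open>- \<i> * \<alpha>\<close> for
  \<open>\<alpha>\<close>, so the weighted gradient is, up to the factor
  \<open>\<sigma>\<^sub>1\<close>, a rotated gradient on both sides of the circle, and a rotated
  gradient stays divergence free when the kink is smoothed. Thus one divergence theorem, on the unit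
  disk, serves every disk. The constant \<open>\<kappa>\<close> is fixed by the matching of the
  fluxes, \<open>\<sigma>\<^sub>2 * (1 + \<kappa>) = \<sigma>\<^sub>1 * (1 - \<kappa>)\<close>. Two
  values of n occur because the pairings with cos for n = 1 depend on the disk through its radius
  alone, and those for n = 2 through its centre alone.\<close>

section \<open>The divergence theorem on the unit disk\<close>

lemma measurable_Complex [measurable]:
  "(\<lambda>p. Complex (fst p) (snd p)) \<in> borel_measurable (lborel \<Otimes>\<^sub>M lborel)"
proof -
  have "(\<lambda>p::real\<times>real. Complex (fst p) (snd p)) \<in> borel_measurable borel"
    by (intro borel_measurable_continuous_onI) (auto simp: Complex_eq intro!: continuous_intros)
  then show ?thesis
    by (simp add: lborel_prod)
qed

text \<open>Lebesgue measure is determined by its values on boxes, and a box of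
  \<open>complex\<close> is a product of two intervals. This opens the plane to Fubini in the
  coordinates \<open>Re\<close> and \<open>Im\<close>.\<close>

lemma lborel_complex:
  "lborel = distr (lborel \<Otimes>\<^sub>M lborel) borel (\<lambda>p. Complex (fst p) (snd p))"
proof (rule lborel_eqI)
  fix l u :: complex
  assume le: "\<And>b. b \<in> Basis \<Longrightarrow> l \<bullet> b \<le> u \<bullet> b"
  have 1: "Re l \<le> Re u" "Im l \<le> Im u"
    using le[of 1] le[of \<i>] by (auto simp: Basis_complex_def)
  have "(\<lambda>p. Complex (fst p) (snd p)) -` box l u \<inter> space (lborel \<Otimes>\<^sub>M lborel)
      = {Re l<..<Re u} \<times> {Im l<..<Im u}"
    by (auto simp: box_def Basis_complex_def space_pair_measure)
  then have "emeasure (distr (lborel \<Otimes>\<^sub>M lborel) borel (\<lambda>p. Complex (fst p) (snd p))) (box l u)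
      = emeasure (lborel \<Otimes>\<^sub>M lborel) ({Re l<..<Re u} \<times> {Im l<..<Im u})"
    by (subst emeasure_distr) auto
  also have "\<dots> = ennreal (Re u - Re l) * ennreal (Im u - Im l)"
    using 1 by (subst lborel.emeasure_pair_measure_Times) auto
  also have "\<dots> = ennreal (\<Prod>b\<in>Basis. (u - l) \<bullet> b)"
    using 1 by (simp add: Basis_complex_def ennreal_mult)
  finally show "emeasure (distr (lborel \<Otimes>\<^sub>M lborel) borel (\<lambda>p. Complex (fst p) (snd p))) (box l u)
      = ennreal (\<Prod>b\<in>Basis. (u - l) \<bullet> b)" .
qed simp

text \<open>Reflection in the diagonal exchanges the two factors of the product measure. It will
  turn the \<open>Re\<close> half of the divergence theorem into the \<open>Im\<close> half.\<close>

lemma lborel_complex_swap: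
  "lborel = distr lborel borel (\<lambda>z. Complex (Im z) (Re z))"
proof -
  have m: "(\<lambda>z. Complex (Im z) (Re z)) \<in> borel_measurable borel"
    by (intro borel_measurable_continuous_onI) (auto simp: Complex_eq intro!: continuous_intros)
  have m2: "(\<lambda>(x, y). (y, x)) \<in> (lborel \<Otimes>\<^sub>M lborel) \<rightarrow>\<^sub>M (lborel \<Otimes>\<^sub>M (lborel :: real measure))"
    by (rule measurable_pair_swap')
  have "lborel = distr (distr (lborel \<Otimes>\<^sub>M lborel) (lborel \<Otimes>\<^sub>M lborel) (\<lambda>(x, y). (y, x)))
      borel (\<lambda>p. Complex (fst p) (snd p))"
    by (simp flip: lborel_pair.distr_pair_swap lborel_complex)
  also have "\<dots> = distr (lborel \<Otimes>\<^sub>M lborel) borel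
      ((\<lambda>p. Complex (fst p) (snd p)) \<circ> (\<lambda>(x, y). (y, x)))"
    using m2 by (subst distr_distr) auto
  also have "\<dots> = distr (lborel \<Otimes>\<^sub>M lborel) borel
      ((\<lambda>z. Complex (Im z) (Re z)) \<circ> (\<lambda>p. Complex (fst p) (snd p)))"
    by (intro distr_cong) auto
  also have "\<dots> = distr (distr (lborel \<Otimes>\<^sub>M lborel) borel (\<lambda>p. Complex (fst p) (snd p)))
      borel (\<lambda>z. Complex (Im z) (Re z))"
    using m by (subst distr_distr) auto
  finally show ?thesis
    by (simp flip: lborel_complex)
qed

lemma integral_lebesgue_on_borel:
  fixes f :: "'a::euclidean_space \<Rightarrow> 'b::{banach, second_countable_topology}"
  assumes "f \<in> borel_measurable borel" "S \<in> sets borel"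
  shows "(\<integral>x. f x \<partial>lebesgue_on S) = (\<integral>x. indicator S x *\<^sub>R f x \<partial>lborel)"
  using assms by (simp add: integral_restrict_space integral_completion)

lemma continuous_on_borel_measurable_lebesgue_on:
  fixes f :: "'a::euclidean_space \<Rightarrow> 'b::euclidean_space"
  assumes "continuous_on UNIV f"
  shows "f \<in> borel_measurable (lebesgue_on S)"
  using borel_measurable_continuous_onI[OF assms]
  by (simp add: measurable_completion measurable_restrict_space1)

section \<open>Integrals over intervals and over full periods\<close>

lemma circle_integral_eq:
  fixes f :: "real \<Rightarrow> real"
  assumes "continuous_on UNIV f"
  shows "(\<integral>t. f t \<partial>lebesgue_on {a..b}) = integral {a..b} f"
proof -
  have "continuous_on {a..b} f" using assms continuous_on_subset by blast
  then have "integrable (lebesgue_on {a..b}) f"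
    using continuous_imp_integrable_real by blast
  then show ?thesis
    by (rule lebesgue_integral_eq_integral) simp
qed

text \<open>Let a be the smaller start. Whether or not the two windows overlap, their integrals
  differ by those over \<open>{a..b}\<close> and \<open>{a+p..b+p}\<close>, which agree by
  periodicity.\<close>

lemma integral_periodic_shift:
  fixes F :: "real \<Rightarrow> real"
  assumes c: "continuous_on UNIV F" and p: "\<And>t. F (t + p) = F t" and "p > 0"
  shows "integral {a..a+p} F = integral {b..b+p} F"
proof -
  have *: "integral {a..a+p} F = integral {b..b+p} F" if "a \<le> b" for a b
  proof (cases "b \<le> a + p")
    case True
    have i: "F integrable_on {x..y}" for x y
      by (intro integrable_continuous_real continuous_on_subset[OF c]) auto
    have "integral {a..a+p} F = integral {a..b} F + integral {b..a+p} F"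
      using that True i by (intro Henstock_Kurzweil_Integration.integral_combine[symmetric]) auto
    moreover have "integral {b..b+p} F = integral {b..a+p} F + integral {a+p..b+p} F"
      using that True i by (intro Henstock_Kurzweil_Integration.integral_combine[symmetric]) auto
    moreover have "integral {a+p..b+p} F = integral {a..b} F"
      using integral_shift[of a p b F] c p by (simp add: o_def continuous_on_subset)
    ultimately show ?thesis by simp
  next
    case False
    have i: "F integrable_on {x..y}" for x y
      by (intro integrable_continuous_real continuous_on_subset[OF c]) auto
    have "integral {a..b+p} F = integral {a..a+p} F + integral {a+p..b+p} F"
      using that False i \<open>p > 0\<close>
      by (intro Henstock_Kurzweil_Integration.integral_combine[symmetric]) auto
    moreover have "integral {a..b+p} F = integral {a..b} F + integral {b..b+p} F"
      using that False i \<open>p > 0\<close>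
      by (intro Henstock_Kurzweil_Integration.integral_combine[symmetric]) auto
    moreover have "integral {a+p..b+p} F = integral {a..b} F"
      using integral_shift[of a p b F] c p by (simp add: o_def continuous_on_subset)
    ultimately show ?thesis by simp
  qed
  show ?thesis
    using *[of a b] *[of b a] by linarith
qed

lemma integral_periodic_reflect:
  fixes F :: "real \<Rightarrow> real"
  assumes c: "continuous_on UNIV F" and p: "\<And>t. F (t + p) = F t" and "p > 0"
  shows "integral {0..p} (\<lambda>t. F (a - t)) = integral {0..p} F"
proof -
  have "integral {0..p} (\<lambda>t. F (a - t)) = integral {-p..0} (\<lambda>t. F (a + t))"
    using Henstock_Kurzweil_Integration.integral_reflect_real[of 0 "-p" "\<lambda>t. F (a + t)"] by simp
  also have "\<dots> = integral {a-p..a} F"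
    using integral_shift[of "-p" a 0 F] c by (simp add: o_def continuous_on_subset add.commute)
  also have "\<dots> = integral {0..p} F"
    using integral_periodic_shift[OF assms, of "a - p" 0] by simp
  finally show ?thesis .
qed

lemma continuous_on_C1:
  assumes "C1_with_gradient \<psi> \<Psi>"
  shows "continuous_on S \<psi>" "continuous_on S \<Psi>"
proof -
  have "isCont \<psi> x" for x
    using assms has_derivative_continuous unfolding C1_with_gradient_def gderiv_def by blast
  then show "continuous_on S \<psi>"
    by (simp add: continuous_at_imp_continuous_on)
  show "continuous_on S \<Psi>"
    using assms continuous_on_subset unfolding C1_with_gradient_def by blast
qed

lemma C1_vector_derivative:
  assumes "C1_with_gradient \<psi> \<Psi>" and "(\<gamma> has_vector_derivative v) (at t within S)"
  shows "((\<lambda>t. \<psi> (\<gamma> t)) has_vector_derivative (v \<bullet> \<Psi> (\<gamma> t))) (at t within S)"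
proof -
  have "(\<psi> has_derivative (\<lambda>h. h \<bullet> \<Psi> (\<gamma> t))) (at (\<gamma> t))"
    using assms(1) unfolding C1_with_gradient_def gderiv_def by blast
  with assms(2) have "((\<lambda>t. \<psi> (\<gamma> t)) has_derivative (\<lambda>h. (h *\<^sub>R v) \<bullet> \<Psi> (\<gamma> t))) (at t within S)"
    unfolding has_vector_derivative_def by (rule has_derivative_compose)
  then show ?thesis
    unfolding has_vector_derivative_def by simp
qed

text \<open>At height y the disk cuts out a chord of half-length
  \<open>sqrt (1 - y\<^sup>2)\<close>, on which the fundamental theorem of calculus leaves the two
  end values. The ends lie on the unit circle: this is where the boundary enters.\<close>

lemma chord_integral:
  assumes \<psi>: "C1_with_gradient \<psi> \<Psi>"
  shows "(\<integral>x. indicator \<Omega> (Complex x y) * Re (\<Psi> (Complex x y)) \<partial>lborel)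
    = indicator {-1..1} y * (\<psi> (Complex (sqrt (1 - y\<^sup>2)) y) - \<psi> (Complex (- sqrt (1 - y\<^sup>2)) y))"
proof (cases "\<bar>y\<bar> \<le> 1")
  case True
  define s where "s = sqrt (1 - y\<^sup>2)"
  have s0: "0 \<le> s" and s2: "s\<^sup>2 = 1 - y\<^sup>2"
    using True abs_square_le_1[of y] by (auto simp: s_def)
  have in_disk: "Complex x y \<in> \<Omega> \<longleftrightarrow> \<bar>x\<bar> < s" for x
  proof -
    have "Complex x y \<in> \<Omega> \<longleftrightarrow> x\<^sup>2 < s\<^sup>2"
      by (simp add: cmod_def s2 real_sqrt_lt_1_iff) linarith
    also have "\<dots> \<longleftrightarrow> \<bar>x\<bar> < s"
      using s0 by (metis abs_of_nonneg abs_le_square_iff linorder_not_le)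
    finally show ?thesis .
  qed
  have cont: "continuous_on A (\<lambda>x. Re (\<Psi> (Complex x y)))" for A
    by (intro continuous_intros continuous_on_compose2[OF continuous_on_C1(2)[OF \<psi>]])
      (auto simp: Complex_eq intro!: continuous_intros)
  have m: "(\<lambda>x. Re (\<Psi> (Complex x y))) \<in> borel_measurable borel"
    by (intro borel_measurable_continuous_onI cont)
  have "(\<integral>x. indicator \<Omega> (Complex x y) * Re (\<Psi> (Complex x y)) \<partial>lborel)
      = (\<integral>x. indicator {-s<..<s} x * Re (\<Psi> (Complex x y)) \<partial>lborel)"
  proof -
    have "indicator \<Omega> (Complex x y) = (indicator {-s<..<s} x :: real)" for x
      by (simp only: indicator_def in_disk) auto
    then show ?thesis by simp
  qed
  \<comment> \<open>Closing the chord adds a null set and gives the closed interval that the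
    fundamental theorem expects.\<close>
  also have "\<dots> = (\<integral>x. indicator {-s..s} x *\<^sub>R Re (\<Psi> (Complex x y)) \<partial>lborel)"
  proof (intro integral_cong_AE)
    show "AE x in lborel. indicator {-s<..<s} x * Re (\<Psi> (Complex x y))
        = indicator {-s..s} x *\<^sub>R Re (\<Psi> (Complex x y))"
      using AE_lborel_singleton[of s] AE_lborel_singleton[of "-s"]
      by eventually_elim (auto simp: indicator_def)
  qed (use m in measurable)
  also have "\<dots> = \<psi> (Complex s y) - \<psi> (Complex (- s) y)"
  proof (rule integral_FTC_atLeastAtMost)
    fix x
    have "((\<lambda>x. \<psi> (Complex x y)) has_vector_derivative (1 \<bullet> \<Psi> (Complex x y))) (at x within {- s..s})"
      by (rule C1_vector_derivative[OF \<psi>]) (auto simp: Complex_eq intro!: derivative_eq_intros)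
    then show "((\<lambda>x. \<psi> (Complex x y)) has_vector_derivative Re (\<Psi> (Complex x y))) (at x within {- s..s})"
      by simp
  qed (use s0 cont in auto)
  finally show ?thesis
    using True by (simp add: s_def abs_le_iff)
next
  case False
  have "\<bar>y\<bar> \<le> cmod (Complex x y)" for x
    using abs_Im_le_cmod[of "Complex x y"] by simp
  then have "Complex x y \<notin> \<Omega>" for x
    using False by (smt (verit, best) dist_0_norm mem_ball)
  then show ?thesis
    using False by (auto simp: indicator_def abs_le_iff)
qed

text \<open>The weight \<open>cos t\<close> is the \<open>Re\<close> component of the outward normal
  \<open>cis t\<close>. Fubini reduces the claim to horizontal chords; y = sin t parametrizes their
  right ends, and reflection in the imaginary axis gives the left ends.\<close>

lemma disk_divergence_Re:
  assumes \<psi>: "C1_with_gradient \<psi> \<Psi>"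
  shows "(\<integral>z. Re (\<Psi> z) \<partial>lebesgue_on \<Omega>) = (\<integral>t. \<psi> (cis t) * cos t \<partial>lebesgue_on {0..2*pi})"
proof -
  define F where "F z = indicator \<Omega> z * Re (\<Psi> z)" for z
  define h where "h y = \<psi> (Complex (sqrt (1 - y\<^sup>2)) y) - \<psi> (Complex (- sqrt (1 - y\<^sup>2)) y)" for y
  have cont: "continuous_on A (\<lambda>z. Re (\<Psi> z))" for A
    by (intro continuous_intros continuous_on_C1(2)[OF \<psi>])
  have m: "(\<lambda>z. Re (\<Psi> z)) \<in> borel_measurable borel"
    by (intro borel_measurable_continuous_onI cont)
  have "compact ((\<lambda>z. Re (\<Psi> z)) ` cball 0 1)"
    by (intro compact_continuous_image cont) auto
  then obtain B where B: "\<And>z. z \<in> cball 0 1 \<Longrightarrow> \<bar>Re (\<Psi> z)\<bar> \<le> B"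
    unfolding bounded_iff by (force dest!: compact_imp_bounded simp: bounded_iff)
  have mF: "F \<in> borel_measurable borel"
    unfolding F_def by (intro borel_measurable_times borel_measurable_indicator m) simp
  have iF: "integrable lborel F"
  proof -
    have "integrable lborel (\<lambda>z. indicator \<Omega> z *\<^sub>R B)"
      using emeasure_bounded_finite[of "\<Omega>"]
      by (intro integrable_real_indicator integrable_scaleR_left) auto
    then show ?thesis
    proof (rule Bochner_Integration.integrable_bound)
      show "AE z in lborel. norm (F z) \<le> norm (indicator \<Omega> z *\<^sub>R B)"
      proof (rule AE_I2)
        fix z :: complex
        show "norm (F z) \<le> norm (indicator \<Omega> z *\<^sub>R B)"
          using B[of z] by (auto simp: F_def indicator_def)
      qed
    qed (use mF in simp)
  qed
  have iF2: "integrable (lborel \<Otimes>\<^sub>M lborel) (\<lambda>p. F (Complex (fst p) (snd p)))"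
    using iF mF by (subst (asm) lborel_complex) (simp add: integrable_distr_eq)
  have "(\<integral>z. Re (\<Psi> z) \<partial>lebesgue_on \<Omega>) = (\<integral>z. F z \<partial>lborel)"
    using m by (simp add: integral_lebesgue_on_borel F_def)
  also have "\<dots> = (\<integral>p. F (Complex (fst p) (snd p)) \<partial>(lborel \<Otimes>\<^sub>M lborel))"
    using mF by (subst lborel_complex) (simp add: integral_distr)
  also have "\<dots> = (\<integral>y. (\<integral>x. F (Complex x y) \<partial>lborel) \<partial>lborel)"
    using lborel_pair.integral_snd[of "\<lambda>x y. F (Complex x y)"] iF2 by (simp add: case_prod_unfold)
  also have "\<dots> = (\<integral>y. indicator {-1..1} y *\<^sub>R h y \<partial>lborel)"
    unfolding F_def chord_integral[OF \<psi>] h_def by simp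
  also have "\<dots> = integral {-1..1} h"
  proof -
    have "continuous_on {-1..1} h"
      unfolding h_def
      by (intro continuous_intros continuous_on_compose2[OF continuous_on_C1(1)[OF \<psi>, of UNIV]])
        (auto simp: Complex_eq intro!: continuous_intros)
    then have "set_integrable lborel {-1..1} h"
      by (rule borel_integrable_atLeastAtMost')
    then show ?thesis
      using set_borel_integral_eq_integral(2)[of "{-1..1}" h] by (simp add: set_lebesgue_integral_def)
  qed
  also have "\<dots> = integral {-(pi/2)..pi/2} (\<lambda>t. cos t *\<^sub>R h (sin t))"
  proof -
    have "((\<lambda>t. cos t *\<^sub>R h (sin t)) has_integral integral {sin (-(pi/2))..sin (pi/2)} h) {-(pi/2)..pi/2}"
    proof (rule has_integral_substitution[where c="-1" and d=1])
      show "continuous_on {-1..1} h"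
        unfolding h_def
        by (intro continuous_intros continuous_on_compose2[OF continuous_on_C1(1)[OF \<psi>, of UNIV]])
          (auto simp: Complex_eq intro!: continuous_intros)
    qed (auto intro!: derivative_eq_intros)
    then show ?thesis
      by (simp add: integral_unique)
  qed
  \<comment> \<open>The left end of the chord at height \<open>sin t\<close> is
    \<open>cis (pi - t)\<close>. Its cosine is \<open>- cos t\<close>, which turns the difference in
    \<open>h\<close> into a sum over the two half circles.\<close>
  also have "\<dots> = integral {-(pi/2)..pi/2} (\<lambda>t. \<psi> (cis t) * cos t + \<psi> (cis (pi - t)) * cos (pi - t))"
  proof (intro Henstock_Kurzweil_Integration.integral_cong)
    fix t assume t: "t \<in> {-(pi/2)..pi/2}"
    then have "sqrt (1 - (sin t)\<^sup>2) = cos t"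
      by (simp add: cos_squared_eq[symmetric] cos_ge_zero)
    then show "cos t *\<^sub>R h (sin t) = \<psi> (cis t) * cos t + \<psi> (cis (pi - t)) * cos (pi - t)"
      by (simp add: h_def cis.ctr cos_diff sin_diff algebra_simps)
  qed
  also have "\<dots> = integral {0..2*pi} (\<lambda>t. \<psi> (cis t) * cos t)"
  proof -
    define G where "G t = \<psi> (cis t) * cos t" for t
    have cG: "continuous_on A G" for A
      unfolding G_def
      by (intro continuous_intros continuous_on_compose2[OF continuous_on_C1(1)[OF \<psi>, of UNIV]]) auto
    have iG: "G integrable_on {a..b}" for a b
      by (intro integrable_continuous_real cG)
    have iG': "(\<lambda>t. G (pi - t)) integrable_on {a..b}" for a b
      by (intro integrable_continuous_real continuous_on_compose2[OF cG[of UNIV]]) (auto intro!: continuous_intros)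
    have "integral {-(pi/2)..pi/2} (\<lambda>t. G t + G (pi - t))
        = integral {-(pi/2)..pi/2} G + integral {-(pi/2)..pi/2} (\<lambda>t. G (pi - t))"
      by (intro Henstock_Kurzweil_Integration.integral_add iG iG')
    \<comment> \<open>Reflecting t and then shifting by pi carries this half to the interval from
      pi/2 to 3 pi/2, which completes a full period.\<close>
    also have "integral {-(pi/2)..pi/2} (\<lambda>t. G (pi - t)) = integral {-(pi/2)..pi/2} (\<lambda>t. G (t + pi))"
      using Henstock_Kurzweil_Integration.integral_reflect_real[of "pi/2" "-(pi/2)" "\<lambda>t. G (t + pi)"] by simp
    also have "\<dots> = integral {pi/2..pi/2 + pi} G"
      using integral_shift[of "-(pi/2)" pi "pi/2" G] cG by (simp add: o_def)
    also have "integral {-(pi/2)..pi/2} G + \<dots> = integral {-(pi/2)..-(pi/2) + 2*pi} G"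
      by (subst Henstock_Kurzweil_Integration.integral_combine) (use iG in auto)
    also have "\<dots> = integral {0..0 + 2*pi} G"
      by (rule integral_periodic_shift[OF cG]) (auto simp: G_def cis.ctr)
    finally show ?thesis
      by (simp add: G_def[abs_def])
  qed
  also have "\<dots> = (\<integral>t. \<psi> (cis t) * cos t \<partial>lebesgue_on {0..2*pi})"
    by (intro circle_integral_eq[symmetric] continuous_intros
        continuous_on_compose2[OF continuous_on_C1(1)[OF \<psi>, of UNIV]]) auto
  finally show ?thesis .
qed

text \<open>Composing with the reflection \<open>T\<close> exchanges the coordinates and hence
  \<open>Re\<close> and \<open>Im\<close> of the gradient. On the circle \<open>T\<close> acts as t
  to pi/2 - t, which exchanges cosine and sine.\<close>

lemma disk_divergence_Im:
  assumes \<psi>: "C1_with_gradient \<psi> \<Psi>"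
  shows "(\<integral>z. Im (\<Psi> z) \<partial>lebesgue_on \<Omega>) = (\<integral>t. \<psi> (cis t) * sin t \<partial>lebesgue_on {0..2*pi})"
proof -
  define T where "T z = Complex (Im z) (Re z)" for z
  have T: "T z = \<i> * cnj z" for z
    by (auto simp: T_def complex_eq_iff)
  have cT: "continuous_on UNIV T"
    unfolding T by (intro continuous_intros)
  have mT: "T \<in> borel_measurable borel"
    by (intro borel_measurable_continuous_onI cT)
  have "C1_with_gradient (\<lambda>z. \<psi> (T z)) (\<lambda>z. T (\<Psi> (T z)))"
    unfolding C1_with_gradient_def gderiv_def
  proof (intro conjI allI)
    fix z
    have "(T has_derivative T) (at z)"
      unfolding T by (auto intro!: derivative_eq_intros)
    moreover have "(\<psi> has_derivative (\<lambda>h. h \<bullet> \<Psi> (T z))) (at (T z))"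
      using \<psi> unfolding C1_with_gradient_def gderiv_def by blast
    ultimately have "((\<lambda>z. \<psi> (T z)) has_derivative (\<lambda>h. T h \<bullet> \<Psi> (T z))) (at z)"
      by (rule has_derivative_compose)
    moreover have "T h \<bullet> \<Psi> (T z) = h \<bullet> T (\<Psi> (T z))" for h
      by (simp add: T_def inner_complex_def)
    ultimately show "((\<lambda>z. \<psi> (T z)) has_derivative (\<lambda>h. h \<bullet> T (\<Psi> (T z)))) (at z)"
      by simp
    show "continuous_on UNIV (\<lambda>z. T (\<Psi> (T z)))"
      by (intro continuous_on_compose2[OF cT] continuous_on_compose2[OF continuous_on_C1(2)[OF \<psi>, of UNIV]] cT) auto
  qed
  from disk_divergence_Re[OF this]
  have "(\<integral>z. Im (\<Psi> (T z)) \<partial>lebesgue_on \<Omega>) = (\<integral>t. \<psi> (T (cis t)) * cos t \<partial>lebesgue_on {0..2*pi})"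
    by (simp add: T_def)
  also have "\<dots> = integral {0..2*pi} (\<lambda>t. \<psi> (cis (pi/2 - t)) * sin (pi/2 - t))"
  proof -
    have "T (cis t) = cis (pi/2 - t)" for t
      by (simp add: T_def complex_eq_iff cos_diff sin_diff)
    then show ?thesis
      by (subst circle_integral_eq)
        (auto simp: sin_diff intro!: continuous_intros continuous_on_compose2[OF continuous_on_C1(1)[OF \<psi>, of UNIV]])
  qed
  also have "\<dots> = integral {0..2*pi} (\<lambda>t. \<psi> (cis t) * sin t)"
    by (rule integral_periodic_reflect[where F="\<lambda>t. \<psi> (cis t) * sin t"])
      (auto simp: cis.ctr intro!: continuous_intros continuous_on_compose2[OF continuous_on_C1(1)[OF \<psi>, of UNIV]])
  also have "\<dots> = (\<integral>t. \<psi> (cis t) * sin t \<partial>lebesgue_on {0..2*pi})"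
    by (intro circle_integral_eq[symmetric] continuous_intros
        continuous_on_compose2[OF continuous_on_C1(1)[OF \<psi>, of UNIV]]) auto
  \<comment> \<open>Change of variables by \<open>T\<close>, which preserves the disk and Lebesgue
    measure.\<close>
  also have "(\<integral>z. Im (\<Psi> (T z)) \<partial>lebesgue_on \<Omega>) = (\<integral>z. Im (\<Psi> z) \<partial>lebesgue_on \<Omega>)"
  proof -
    have m: "(\<lambda>z. Im (\<Psi> z)) \<in> borel_measurable borel"
      by (intro borel_measurable_continuous_onI continuous_intros continuous_on_C1(2)[OF \<psi>])
    have m': "(\<lambda>z. Im (\<Psi> (T z))) \<in> borel_measurable borel"
      using measurable_compose[OF mT m] .
    have "indicator \<Omega> (T z) = (indicator \<Omega> z :: real)" for z
      by (simp add: T norm_mult indicator_def)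
    then have "(\<integral>z. indicator \<Omega> z *\<^sub>R Im (\<Psi> (T z)) \<partial>lborel)
        = (\<integral>z. indicator \<Omega> (T z) *\<^sub>R Im (\<Psi> (T z)) \<partial>lborel)"
      by simp
    also have "\<dots> = (\<integral>z. indicator \<Omega> z *\<^sub>R Im (\<Psi> z) \<partial>distr lborel borel T)"
      using mT by (subst integral_distr)
        (auto intro!: borel_measurable_times borel_measurable_indicator m)
    also have "distr lborel borel T = lborel"
      using lborel_complex_swap by (simp add: T_def[abs_def])
    finally show ?thesis
      using m m' by (simp add: integral_lebesgue_on_borel)
  qed
  finally show ?thesis .
qed

section \<open>Square-integrable functions and continuously differentiable functions\<close>

lemma L2D:
  assumes "f \<in> L2 M"
  shows "f \<in> borel_measurable M" "integrable M (\<lambda>x. (norm (f x))\<^sup>2)"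
  using assms unfolding L2_def by auto

lemma L2_bounded:
  assumes "finite_measure M" "f \<in> borel_measurable M" "\<And>x. x \<in> space M \<Longrightarrow> norm (f x) \<le> B"
  shows "f \<in> L2 M"
proof -
  interpret finite_measure M by fact
  have "integrable M (\<lambda>x. (norm (f x))\<^sup>2)"
  proof (rule integrable_const_bound[of _ "B\<^sup>2"])
    show "AE x in M. norm ((norm (f x))\<^sup>2) \<le> B\<^sup>2"
      using assms(3) by (auto intro!: AE_I2 power_mono)
  qed (use assms(2) in measurable)
  with assms(2) show ?thesis by (simp add: L2_def)
qed

lemma L2_scaleR:
  fixes f :: "'a \<Rightarrow> 'b::{real_normed_vector, second_countable_topology}"
  assumes "f \<in> L2 M"
  shows "(\<lambda>x. c *\<^sub>R f x) \<in> L2 M"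
  using assms unfolding L2_def by (auto simp: power_mult_distrib)

lemma L2_add:
  fixes f g :: "'a \<Rightarrow> 'b::{real_normed_vector, second_countable_topology}"
  assumes "f \<in> L2 M" "g \<in> L2 M"
  shows "(\<lambda>x. f x + g x) \<in> L2 M"
proof -
  note [measurable] = L2D(1)[OF assms(1)] L2D(1)[OF assms(2)]
  have "(norm (a + b))\<^sup>2 \<le> 2 * (norm a)\<^sup>2 + 2 * (norm b)\<^sup>2" for a b :: 'b
  proof -
    have "(norm (a + b))\<^sup>2 \<le> (norm a + norm b)\<^sup>2"
      by (intro power_mono norm_triangle_ineq) auto
    also have "\<dots> \<le> 2 * (norm a)\<^sup>2 + 2 * (norm b)\<^sup>2"
      using sum_squares_bound[of "norm a" "norm b"] by (simp add: power2_sum)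
    finally show ?thesis .
  qed
  then have le: "norm ((norm (f x + g x))\<^sup>2) \<le> norm (2 * (norm (f x))\<^sup>2 + 2 * (norm (g x))\<^sup>2)" for x
    by (simp add: abs_of_nonneg)
  have "integrable M (\<lambda>x. (norm (f x + g x))\<^sup>2)"
  proof (rule Bochner_Integration.integrable_bound)
    show "integrable M (\<lambda>x. 2 * (norm (f x))\<^sup>2 + 2 * (norm (g x))\<^sup>2)"
      using L2D(2)[OF assms(1)] L2D(2)[OF assms(2)] by simp
    show "AE x in M. norm ((norm (f x + g x))\<^sup>2) \<le> norm (2 * (norm (f x))\<^sup>2 + 2 * (norm (g x))\<^sup>2)"
      by (intro AE_I2 le)
  qed measurable
  then show ?thesis
    by (simp add: L2_def)
qed

lemma L2_diff:
  fixes f g :: "'a \<Rightarrow> 'b::{real_normed_vector, second_countable_topology}"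
  assumes "f \<in> L2 M" "g \<in> L2 M"
  shows "(\<lambda>x. f x - g x) \<in> L2 M"
  using L2_add[OF assms(1) L2_scaleR[OF assms(2), of "-1"]] by simp

text \<open>A product of norms is at most the sum of their squares. Allowing any bounded bilinear
  map covers scalar products, scalar multiples and products at once.\<close>

lemma L2_bilinear_integrable:
  fixes h :: "'b::{real_normed_vector, second_countable_topology} \<Rightarrow>
    'c::{real_normed_vector, second_countable_topology} \<Rightarrow> 'd::{banach, second_countable_topology}"
  assumes h: "bounded_bilinear h" and f: "f \<in> L2 M" and g: "g \<in> L2 M"
  shows "integrable M (\<lambda>x. h (f x) (g x))"
proof -
  note [measurable] = L2D(1)[OF f] L2D(1)[OF g]
  obtain K where K: "0 < K" "\<And>a b. norm (h a b) \<le> norm a * norm b * K"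
    using bounded_bilinear.pos_bounded[OF h] by blast
  have le: "norm (h a b) \<le> K * ((norm a)\<^sup>2 + (norm b)\<^sup>2)" for a b
  proof -
    have "norm a * norm b \<le> (norm a)\<^sup>2 + (norm b)\<^sup>2"
      using sum_squares_bound[of "norm a" "norm b"] mult_nonneg_nonneg[of "norm a" "norm b"]
      by (simp del: mult_nonneg_nonneg)
    then show ?thesis
      using K(1) K(2)[of a b] by (smt (verit) mult.commute mult_left_mono)
  qed
  show ?thesis
  proof (rule Bochner_Integration.integrable_bound)
    show "integrable M (\<lambda>x. K * ((norm (f x))\<^sup>2 + (norm (g x))\<^sup>2))"
      using L2D(2)[OF f] L2D(2)[OF g] by simp
    show "(\<lambda>x. h (f x) (g x)) \<in> borel_measurable M"
      using L2D(1)[OF f] L2D(1)[OF g]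
      by (rule borel_measurable_continuous_Pair)
        (intro bounded_bilinear.continuous_on[OF h] continuous_intros)
    show "AE x in M. norm (h (f x) (g x)) \<le> norm (K * ((norm (f x))\<^sup>2 + (norm (g x))\<^sup>2))"
      using K(1) le by (auto intro!: AE_I2)
  qed
qed

lemmas L2_inner_integrable = L2_bilinear_integrable[OF bounded_bilinear_inner]
lemmas L2_scaleR_integrable = L2_bilinear_integrable[OF bounded_bilinear_scaleR]

text \<open>The weighted inequality
  \<open>a * b \<le> d / 2 * b\<^sup>2 + a\<^sup>2 / (2 * d)\<close> takes the place of
  Cauchy-Schwarz: a small d absorbs the fixed factor \<open>g\<close>, and the convergence of
  \<open>F\<close> then beats 1 / d.\<close>

lemma tendsto_L2_bilinear:
  fixes h :: "'b::{real_normed_vector, second_countable_topology} \<Rightarrow>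
    'c::{real_normed_vector, second_countable_topology} \<Rightarrow> 'd::{banach, second_countable_topology}"
  assumes h: "bounded_bilinear h" and F: "\<And>n. F n \<in> L2 M" and f: "f \<in> L2 M" and g: "g \<in> L2 M"
    and lim: "tendsto_L2 M F f"
  shows "(\<lambda>n. \<integral>x. h (F n x) (g x) \<partial>M) \<longlonglongrightarrow> (\<integral>x. h (f x) (g x) \<partial>M)"
proof -
  obtain K where K: "0 < K" "\<And>a b. norm (h a b) \<le> norm a * norm b * K"
    using bounded_bilinear.pos_bounded[OF h] by blast
  define A where "A = (\<integral>x. (norm (g x))\<^sup>2 \<partial>M)"
  have A: "0 \<le> A"
    unfolding A_def by (intro Bochner_Integration.integral_nonneg) auto
  have bound: "norm ((\<integral>x. h (F n x) (g x) \<partial>M) - (\<integral>x. h (f x) (g x) \<partial>M))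
      \<le> K * (d / 2 * A + (\<integral>x. (norm (F n x - f x))\<^sup>2 \<partial>M) / (2 * d))" if "d > 0" for d n
  proof -
    have D: "(\<lambda>x. F n x - f x) \<in> L2 M"
      using F f by (rule L2_diff)
    have "(\<integral>x. h (F n x) (g x) \<partial>M) - (\<integral>x. h (f x) (g x) \<partial>M) = (\<integral>x. h (F n x - f x) (g x) \<partial>M)"
      using L2_bilinear_integrable[OF h F g] L2_bilinear_integrable[OF h f g]
      by (simp add: bounded_bilinear.diff_left[OF h])
    also have "norm \<dots> \<le> (\<integral>x. K * (d / 2 * (norm (g x))\<^sup>2 + (norm (F n x - f x))\<^sup>2 / (2 * d)) \<partial>M)"
    proof (rule order.trans[OF integral_norm_bound], rule Bochner_Integration.integral_mono)
      show "integrable M (\<lambda>x. norm (h (F n x - f x) (g x)))"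
        using L2_bilinear_integrable[OF h D g] by simp
      show "integrable M (\<lambda>x. K * (d / 2 * (norm (g x))\<^sup>2 + (norm (F n x - f x))\<^sup>2 / (2 * d)))"
        using L2D(2)[OF D] L2D(2)[OF g] by simp
      fix x
      have "a * b \<le> d / 2 * b\<^sup>2 + a\<^sup>2 / (2 * d)" for a b :: real
      proof -
        have "0 \<le> (a - d * b)\<^sup>2 / (2 * d)"
          using \<open>d > 0\<close> by simp
        also have "\<dots> = d / 2 * b\<^sup>2 + a\<^sup>2 / (2 * d) - a * b"
          using \<open>d > 0\<close> by (simp add: power2_eq_square field_simps)
        finally show ?thesis by simp
      qed
      from mult_left_mono[OF this[of "norm (F n x - f x)" "norm (g x)"] less_imp_le[OF K(1)]]
      show "norm (h (F n x - f x) (g x)) \<le> K * (d / 2 * (norm (g x))\<^sup>2 + (norm (F n x - f x))\<^sup>2 / (2 * d))"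
        using K(2)[of "F n x - f x" "g x"] by (simp add: mult.commute)
    qed
    also have "\<dots> = K * (d / 2 * A + (\<integral>x. (norm (F n x - f x))\<^sup>2 \<partial>M) / (2 * d))"
      using L2D(2)[OF D] L2D(2)[OF g] by (simp add: A_def)
    finally show ?thesis .
  qed
  show ?thesis
  proof (rule LIMSEQ_I)
    fix e :: real assume "e > 0"
    \<comment> \<open>With this \<open>d\<close> the contribution of \<open>g\<close> stays below e
      / 2; the summand 1 covers the case \<open>A = 0\<close>.\<close>
    define d where "d = e / (K * A + 1)"
    have KA: "K * A \<ge> 0" using K(1) A by simp
    have d: "d > 0" using \<open>e > 0\<close> KA by (simp add: d_def add_nonneg_pos)
    have "d * (K * A + 1) = e"
      using KA by (simp add: d_def)
    then have 1: "K * (d / 2 * A) < e / 2"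
      using d by (simp add: algebra_simps)
    have "0 < e * d / K" using \<open>e > 0\<close> d K(1) by simp
    then obtain N where N: "\<And>n. n \<ge> N \<Longrightarrow> norm (\<integral>x. (norm (F n x - f x))\<^sup>2 \<partial>M) < e * d / K"
      using LIMSEQ_D[OF lim[unfolded tendsto_L2_def], of "e * d / K"] by auto
    have "norm ((\<integral>x. h (F n x) (g x) \<partial>M) - (\<integral>x. h (f x) (g x) \<partial>M)) < e" if "n \<ge> N" for n
    proof -
      have "(\<integral>x. (norm (F n x - f x))\<^sup>2 \<partial>M) < e * d / K"
        using N[OF that] by simp
      then have "K * ((\<integral>x. (norm (F n x - f x))\<^sup>2 \<partial>M) / (2 * d)) < e / 2"
        using K(1) d by (simp add: field_simps)
      with 1 bound[OF d, of n] show ?thesis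
        by (simp add: distrib_left)
    qed
    then show "\<exists>N. \<forall>n\<ge>N. norm ((\<integral>x. h (F n x) (g x) \<partial>M) - (\<integral>x. h (f x) (g x) \<partial>M)) < e"
      by blast
  qed
qed

lemma tendsto_L2_bounded_convergence:
  fixes f :: "'a \<Rightarrow> 'b::{real_normed_vector, second_countable_topology}"
  assumes fin: "finite_measure M" and F: "\<And>n. F n \<in> borel_measurable M" and f: "f \<in> borel_measurable M"
    and lim: "\<And>x. x \<in> space M \<Longrightarrow> (\<lambda>n. F n x) \<longlonglongrightarrow> f x"
    and bound: "\<And>n x. x \<in> space M \<Longrightarrow> norm (F n x) \<le> B"
  shows "tendsto_L2 M F f"
proof -
  interpret finite_measure M by fact
  have fB: "norm (f x) \<le> B" if "x \<in> space M" for x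
    using tendsto_norm[OF lim[OF that]] by (rule LIMSEQ_le_const2) (use bound that in blast)
  have "(\<lambda>n. \<integral>x. (norm (F n x - f x))\<^sup>2 \<partial>M) \<longlonglongrightarrow> (\<integral>x. 0 \<partial>M)"
  proof (rule integral_dominated_convergence[where w="\<lambda>_. (2 * B)\<^sup>2"])
    show "AE x in M. (\<lambda>n. (norm (F n x - f x))\<^sup>2) \<longlonglongrightarrow> 0"
    proof (rule AE_I2)
      fix x assume "x \<in> space M"
      then have "(\<lambda>n. (norm (F n x - f x))\<^sup>2) \<longlonglongrightarrow> (norm (f x - f x))\<^sup>2"
        by (intro tendsto_intros lim)
      then show "(\<lambda>n. (norm (F n x - f x))\<^sup>2) \<longlonglongrightarrow> 0" by simp
    qed
    show "AE x in M. norm ((norm (F n x - f x))\<^sup>2) \<le> (2 * B)\<^sup>2" for n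
    proof (rule AE_I2)
      fix x assume x: "x \<in> space M"
      have "norm (F n x - f x) \<le> 2 * B"
        using bound[OF x, of n] fB[OF x] norm_triangle_ineq4[of "F n x" "f x"] by linarith
      then show "norm ((norm (F n x - f x))\<^sup>2) \<le> (2 * B)\<^sup>2"
        using power_mono[of "norm (F n x - f x)" "2 * B" 2] by simp
    qed
  qed (use F f in \<open>simp_all add: borel_measurable_diff borel_measurable_norm borel_measurable_power\<close>)
  then show ?thesis by (simp add: tendsto_L2_def)
qed

lemma tendsto_L2_diff:
  fixes f g :: "'a \<Rightarrow> 'b::{real_normed_vector, second_countable_topology}"
  assumes F: "\<And>n. F n \<in> L2 M" "f \<in> L2 M" "tendsto_L2 M F f"
    and G: "\<And>n. G n \<in> L2 M" "g \<in> L2 M" "tendsto_L2 M G g"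
  shows "tendsto_L2 M (\<lambda>n x. F n x - G n x) (\<lambda>x. f x - g x)"
  unfolding tendsto_L2_def
proof (rule tendsto_sandwich[OF always_eventually always_eventually tendsto_const])
  show "\<forall>n. 0 \<le> (\<integral>x. (norm (F n x - G n x - (f x - g x)))\<^sup>2 \<partial>M)"
    by (intro allI Bochner_Integration.integral_nonneg) auto
  show "(\<lambda>n. 2 * (\<integral>x. (norm (F n x - f x))\<^sup>2 \<partial>M) + 2 * (\<integral>x. (norm (G n x - g x))\<^sup>2 \<partial>M)) \<longlonglongrightarrow> 0"
    using tendsto_add[OF tendsto_mult_left[of _ _ _ 2] tendsto_mult_left[of _ _ _ 2], OF F(3)[unfolded tendsto_L2_def] G(3)[unfolded tendsto_L2_def]]
    by simp
  show "\<forall>n. (\<integral>x. (norm (F n x - G n x - (f x - g x)))\<^sup>2 \<partial>M)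
      \<le> 2 * (\<integral>x. (norm (F n x - f x))\<^sup>2 \<partial>M) + 2 * (\<integral>x. (norm (G n x - g x))\<^sup>2 \<partial>M)"
  proof
    fix n
    have i: "integrable M (\<lambda>x. (norm (F n x - f x))\<^sup>2)" "integrable M (\<lambda>x. (norm (G n x - g x))\<^sup>2)"
      "integrable M (\<lambda>x. (norm (F n x - G n x - (f x - g x)))\<^sup>2)"
      using F(1,2) G(1,2) by (auto intro!: L2D(2) L2_diff)
    have "(\<integral>x. (norm (F n x - G n x - (f x - g x)))\<^sup>2 \<partial>M)
        \<le> (\<integral>x. 2 * (norm (F n x - f x))\<^sup>2 + 2 * (norm (G n x - g x))\<^sup>2 \<partial>M)"
    proof (rule Bochner_Integration.integral_mono)
      fix x
      let ?a = "F n x - f x" and ?b = "G n x - g x"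
      have "norm (F n x - G n x - (f x - g x)) \<le> norm ?a + norm ?b"
        using norm_triangle_ineq4[of ?a ?b] by (simp add: algebra_simps)
      then have "(norm (F n x - G n x - (f x - g x)))\<^sup>2 \<le> (norm ?a + norm ?b)\<^sup>2"
        by (intro power_mono) auto
      also have "\<dots> \<le> 2 * (norm ?a)\<^sup>2 + 2 * (norm ?b)\<^sup>2"
        using sum_squares_bound[of "norm ?a" "norm ?b"] by (simp add: power2_sum)
      finally show "(norm (F n x - G n x - (f x - g x)))\<^sup>2 \<le> 2 * (norm ?a)\<^sup>2 + 2 * (norm ?b)\<^sup>2" .
    qed (use i in auto)
    also have "\<dots> = 2 * (\<integral>x. (norm (F n x - f x))\<^sup>2 \<partial>M) + 2 * (\<integral>x. (norm (G n x - g x))\<^sup>2 \<partial>M)"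
      using i by simp
    finally show "(\<integral>x. (norm (F n x - G n x - (f x - g x)))\<^sup>2 \<partial>M)
      \<le> 2 * (\<integral>x. (norm (F n x - f x))\<^sup>2 \<partial>M) + 2 * (\<integral>x. (norm (G n x - g x))\<^sup>2 \<partial>M)" .
  qed
qed

text \<open>Since \<open>grad u\<close> is a choice of representative, limits are first computed for
  an explicit gradient and then moved to the chosen one in this way.\<close>

lemma tendsto_L2_AE_cong:
  fixes f g :: "'a \<Rightarrow> 'b::{real_normed_vector, second_countable_topology}"
  assumes "\<And>n. F n \<in> borel_measurable M" "f \<in> borel_measurable M" "g \<in> borel_measurable M"
    and "AE x in M. f x = g x" and "tendsto_L2 M F f"
  shows "tendsto_L2 M F g"
proof -
  have "(\<integral>x. (norm (F n x - f x))\<^sup>2 \<partial>M) = (\<integral>x. (norm (F n x - g x))\<^sup>2 \<partial>M)" for n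
    using assms(4) by (intro integral_cong_AE)
      (use assms(1-3) in \<open>auto simp: borel_measurable_diff borel_measurable_norm borel_measurable_power\<close>)
  with assms(5) show ?thesis
    by (simp add: tendsto_L2_def)
qed

section \<open>Calculus with continuously differentiable functions and their gradients\<close>

lemma C1_const: "C1_with_gradient (\<lambda>z. c) (\<lambda>z. 0)"
  by (simp add: C1_with_gradient_def GDERIV_const)

lemma C1_add:
  assumes "C1_with_gradient \<phi> \<Phi>" "C1_with_gradient \<psi> \<Psi>"
  shows "C1_with_gradient (\<lambda>z. \<phi> z + \<psi> z) (\<lambda>z. \<Phi> z + \<Psi> z)"
  using assms by (auto simp: C1_with_gradient_def intro!: GDERIV_add continuous_intros)

lemma C1_diff:
  assumes "C1_with_gradient \<phi> \<Phi>" "C1_with_gradient \<psi> \<Psi>"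
  shows "C1_with_gradient (\<lambda>z. \<phi> z - \<psi> z) (\<lambda>z. \<Phi> z - \<Psi> z)"
  using assms by (auto simp: C1_with_gradient_def intro!: GDERIV_diff continuous_intros)

lemma C1_mult:
  assumes "C1_with_gradient \<phi> \<Phi>" "C1_with_gradient \<psi> \<Psi>"
  shows "C1_with_gradient (\<lambda>z. \<phi> z * \<psi> z) (\<lambda>z. \<phi> z *\<^sub>R \<Psi> z + \<psi> z *\<^sub>R \<Phi> z)"
  using assms continuous_on_C1[OF assms(1)] continuous_on_C1[OF assms(2)]
  by (auto simp: C1_with_gradient_def intro!: GDERIV_mult continuous_intros)

lemma C1_compose:
  assumes \<phi>: "C1_with_gradient \<phi> \<Phi>"
    and h: "\<And>s. (h has_real_derivative h' s) (at s)" "continuous_on UNIV h'"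
  shows "C1_with_gradient (\<lambda>z. h (\<phi> z)) (\<lambda>z. h' (\<phi> z) *\<^sub>R \<Phi> z)"
  unfolding C1_with_gradient_def
proof (intro conjI allI)
  fix z
  have "GDERIV \<phi> z :> \<Phi> z"
    using \<phi> by (simp add: C1_with_gradient_def)
  then show "GDERIV (\<lambda>z. h (\<phi> z)) z :> h' (\<phi> z) *\<^sub>R \<Phi> z"
    using h(1) by (rule GDERIV_DERIV_compose)
  show "continuous_on UNIV (\<lambda>z. h' (\<phi> z) *\<^sub>R \<Phi> z)"
    by (intro continuous_intros continuous_on_C1[OF \<phi>] continuous_on_compose2[OF h(2)]) auto
qed

lemma C1_linear:
  "C1_with_gradient (\<lambda>z. z \<bullet> a) (\<lambda>z. a)"
  unfolding C1_with_gradient_def gderiv_def by (auto intro!: derivative_eq_intros)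

text \<open>The differential of \<open>Re (f z)\<close> sends h to \<open>Re (f' z * h)\<close>,
  which is the real scalar product of h with \<open>cnj (f' z)\<close>.\<close>

lemma C1_Re_holomorphic:
  assumes "\<And>z. (f has_field_derivative f' z) (at z)" "continuous_on UNIV f'"
  shows "C1_with_gradient (\<lambda>z. Re (f z)) (\<lambda>z. cnj (f' z))"
  unfolding C1_with_gradient_def gderiv_def
proof (intro conjI allI)
  fix z
  have "(f has_derivative (*) (f' z)) (at z)"
    using assms(1) by (simp add: has_field_derivative_def)
  then have "((\<lambda>z. Re (f z)) has_derivative (\<lambda>h. Re (f' z * h))) (at z)"
    by (rule has_derivative_Re)
  then show "((\<lambda>z. Re (f z)) has_derivative (\<lambda>h. h \<bullet> cnj (f' z))) (at z)"
    by (simp add: inner_complex_def algebra_simps)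
qed (intro continuous_intros assms)

lemma C1_Im_holomorphic:
  assumes "\<And>z. (f has_field_derivative f' z) (at z)" "continuous_on UNIV f'"
  shows "C1_with_gradient (\<lambda>z. Im (f z)) (\<lambda>z. \<i> * cnj (f' z))"
proof -
  have "C1_with_gradient (\<lambda>z. Re (- \<i> * f z)) (\<lambda>z. cnj (- \<i> * f' z))"
    by (intro C1_Re_holomorphic DERIV_cmult continuous_intros assms)
  then show ?thesis by simp
qed

text \<open>Polynomials, once multiplied by a cutoff, are the test functions to which
  Stone-Weierstrass will be applied.\<close>

lemma C1_real_polynomial:
  assumes "real_polynomial_function p"
  shows "\<exists>P. C1_with_gradient p P"
  using assms
proof induction
  case (linear f)
  \<comment> \<open>The vector that represents the linear functional \<open>f\<close> as a scalar
    product.\<close>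
  define a where "a = adjoint f 1"
  have "f = (\<lambda>z. z \<bullet> a)"
    using adjoint_works[OF bounded_linear.linear[OF linear], of _ 1] by (auto simp: a_def)
  then show ?case using C1_linear[of a] by auto
next
  case (const c)
  show ?case by (rule exI, rule C1_const)
next
  case (add f g)
  then obtain F G where "C1_with_gradient f F" "C1_with_gradient g G"
    by blast
  then show ?case by - (rule exI, rule C1_add)
next
  case (mult f g)
  then obtain F G where "C1_with_gradient f F" "C1_with_gradient g G"
    by blast
  then show ?case by - (rule exI, rule C1_mult)
qed

interpretation lebesgue_disk: finite_measure "lebesgue_on \<Omega>"
  by (rule finite_measure_lebesgue_on) simp

lemma continuous_L2_disk:
  fixes f :: "complex \<Rightarrow> 'b::euclidean_space"
  assumes "continuous_on UNIV f"
  shows "f \<in> L2 (lebesgue_on \<Omega>)"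
proof -
  have "bounded (f ` cball 0 1)"
    by (intro compact_imp_bounded compact_continuous_image continuous_on_subset[OF assms]) auto
  then obtain B where "\<And>z. z \<in> cball 0 1 \<Longrightarrow> norm (f z) \<le> B"
    unfolding bounded_iff by blast
  then show ?thesis
    by (intro L2_bounded[where B=B] lebesgue_disk.finite_measure_axioms
        continuous_on_borel_measurable_lebesgue_on assms) auto
qed

lemma C1_L2_disk:
  assumes "C1_with_gradient \<psi> \<Psi>"
  shows "\<psi> \<in> L2 (lebesgue_on \<Omega>)" "\<Psi> \<in> L2 (lebesgue_on \<Omega>)"
  using continuous_on_C1[OF assms] by (auto intro!: continuous_L2_disk)

text \<open>A test function vanishes on the unit circle, so the divergence theorem makes the
  gradient of \<open>\<psi> * \<phi>\<close> integrate to zero; the product rule splits this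
  integral into the two sides.\<close>

lemma has_weak_gradient_C1:
  assumes \<psi>: "C1_with_gradient \<psi> \<Psi>"
  shows "has_weak_gradient \<psi> \<Psi>"
  unfolding has_weak_gradient_def
proof (intro allI impI)
  fix \<phi> \<Phi> assume \<phi>: "C1_with_gradient \<phi> \<Phi>" and sub: "closure {x. \<phi> x \<noteq> 0} \<subseteq> \<Omega>"
  have z: "\<phi> (cis t) = 0" for t
  proof -
    have "cis t \<notin> {x. \<phi> x \<noteq> 0}"
    proof
      assume "cis t \<in> {x. \<phi> x \<noteq> 0}"
      then have "cis t \<in> \<Omega>"
        by (rule subsetD[OF subset_trans[OF closure_subset sub]])
      then show False by simp
    qed
    then show ?thesis by simp
  qed
  note m = C1_mult[OF \<psi> \<phi>]
  note i = L2_scaleR_integrable[OF C1_L2_disk(1)[OF \<psi>] C1_L2_disk(2)[OF \<phi>]]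
    L2_scaleR_integrable[OF C1_L2_disk(1)[OF \<phi>] C1_L2_disk(2)[OF \<psi>]]
  let ?F = "\<lambda>x. \<psi> x *\<^sub>R \<Phi> x + \<phi> x *\<^sub>R \<Psi> x"
  let ?I = "\<integral>x. ?F x \<partial>lebesgue_on \<Omega>"
  have iF: "integrable (lebesgue_on \<Omega>) ?F"
    by (intro Bochner_Integration.integrable_add i)
  have "Re ?I = 0"
    unfolding integral_Re[OF iF, symmetric] disk_divergence_Re[OF m] z by simp
  moreover have "Im ?I = 0"
    unfolding integral_Im[OF iF, symmetric] disk_divergence_Im[OF m] z by simp
  ultimately have "?I = 0"
    by (simp add: complex_eq_iff)
  then show "(\<integral>x. \<psi> x *\<^sub>R \<Phi> x \<partial>lebesgue_on \<Omega>) = - (\<integral>x. \<phi> x *\<^sub>R \<Psi> x \<partial>lebesgue_on \<Omega>)"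
    using i by (simp add: eq_neg_iff_add_eq_0)
qed

text \<open>Both sides of the defining identity are pairings with fixed square-integrable functions,
  so they pass to the limit. In this way functions with a kink receive a weak gradient.\<close>

lemma has_weak_gradient_limit:
  assumes C1: "\<And>n. C1_with_gradient (\<psi> n) (\<Psi> n)"
    and u: "u \<in> L2 (lebesgue_on \<Omega>)" "tendsto_L2 (lebesgue_on \<Omega>) \<psi> u"
    and G: "G \<in> L2 (lebesgue_on \<Omega>)" "tendsto_L2 (lebesgue_on \<Omega>) \<Psi> G"
  shows "has_weak_gradient u G"
  unfolding has_weak_gradient_def
proof (intro allI impI)
  fix \<phi> \<Phi> assume \<phi>: "C1_with_gradient \<phi> \<Phi>" "compact (closure {x. \<phi> x \<noteq> 0})" "closure {x. \<phi> x \<noteq> 0} \<subseteq> \<Omega>"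
  have 1: "(\<lambda>n. \<integral>x. \<psi> n x *\<^sub>R \<Phi> x \<partial>lebesgue_on \<Omega>) \<longlonglongrightarrow> (\<integral>x. u x *\<^sub>R \<Phi> x \<partial>lebesgue_on \<Omega>)"
    using C1_L2_disk[OF C1] u C1_L2_disk[OF \<phi>(1)]
    by (intro tendsto_L2_bilinear[OF bounded_bilinear_scaleR])
  have 2: "(\<lambda>n. \<integral>x. \<phi> x *\<^sub>R \<Psi> n x \<partial>lebesgue_on \<Omega>) \<longlonglongrightarrow> (\<integral>x. \<phi> x *\<^sub>R G x \<partial>lebesgue_on \<Omega>)"
    using C1_L2_disk[OF C1] G C1_L2_disk[OF \<phi>(1)]
    by (intro tendsto_L2_bilinear[OF bounded_bilinear.flip[OF bounded_bilinear_scaleR]])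
  have "(\<integral>x. \<psi> n x *\<^sub>R \<Phi> x \<partial>lebesgue_on \<Omega>) = - (\<integral>x. \<phi> x *\<^sub>R \<Psi> n x \<partial>lebesgue_on \<Omega>)" for n
    using has_weak_gradient_C1[OF C1] \<phi> unfolding has_weak_gradient_def by blast
  with 1 tendsto_minus[OF 2] show "(\<integral>x. u x *\<^sub>R \<Phi> x \<partial>lebesgue_on \<Omega>) = - (\<integral>x. \<phi> x *\<^sub>R G x \<partial>lebesgue_on \<Omega>)"
    by (simp add: LIMSEQ_unique)
qed

section \<open>Weak gradients, traces and weak solutions\<close>

text \<open>Squaring removes the corner of the positive part at 0, so that the cutoff built from it
  is C1.\<close>

lemma DERIV_pos_part_sq:
  fixes x :: real
  shows "((\<lambda>x. (max 0 x)\<^sup>2) has_real_derivative 2 * max 0 x) (at x)"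
proof -
  consider "x > 0" | "x < 0" | "x = 0" by linarith
  then show ?thesis
  proof cases
    case 1
    have "((\<lambda>x. x\<^sup>2) has_real_derivative 2 * x) (at x)"
      by (auto intro!: derivative_eq_intros)
    then have "((\<lambda>x. (max 0 x)\<^sup>2) has_real_derivative 2 * x) (at x)"
      by (rule has_field_derivative_transform_within_open[of _ _ _ "{0<..}"]) (use 1 in auto)
    with 1 show ?thesis by simp
  next
    case 2
    have "((\<lambda>x. 0) has_real_derivative 0) (at x)"
      by simp
    then have "((\<lambda>x. (max 0 x)\<^sup>2) has_real_derivative 0) (at x)"
      by (rule has_field_derivative_transform_within_open[of _ _ _ "{..<0}"]) (use 2 in auto)
    with 2 show ?thesis by simp
  next
    case 3
    have "((\<lambda>h::real. ((max 0 h)\<^sup>2) / h) \<longlongrightarrow> 0) (at 0)"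
    proof (rule Lim_null_comparison)
      show "\<forall>\<^sub>F h in at 0. norm ((max 0 h)\<^sup>2 / h) \<le> \<bar>h\<bar>"
        by (intro always_eventually allI) (auto simp: max_def power2_eq_square)
      show "((\<lambda>h::real. \<bar>h\<bar>) \<longlongrightarrow> 0) (at 0)"
        by (intro tendsto_rabs_zero tendsto_ident_at)
    qed
    with 3 show ?thesis
      by (simp add: DERIV_def)
  qed
qed

lemma C1_norm_sq: "C1_with_gradient (\<lambda>z. (norm (z - c))\<^sup>2) (\<lambda>z. 2 *\<^sub>R (z - c))"
  unfolding C1_with_gradient_def gderiv_def power2_norm_eq_inner
  by (auto intro!: derivative_eq_intros continuous_intros simp: inner_commute algebra_simps)

text \<open>A C1 cutoff, positive exactly where the squared modulus is below \<open>a\<close>. For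
  \<open>a < 1\<close> it is supported inside the disk, and as \<open>a\<close> tends to 1 its
  positivity sets exhaust the disk.\<close>

definition bump :: "real \<Rightarrow> complex \<Rightarrow> real" where
  "bump a z = (max 0 (a - (norm z)\<^sup>2))\<^sup>2"

lemma C1_bump: "\<exists>B. C1_with_gradient (bump a) B"
proof -
  have "C1_with_gradient (\<lambda>z. a - (norm (z - 0))\<^sup>2) (\<lambda>z. 0 - 2 *\<^sub>R (z - 0))"
    by (intro C1_diff C1_const C1_norm_sq)
  then have "C1_with_gradient (\<lambda>z. (max 0 (a - (norm (z - 0))\<^sup>2))\<^sup>2)
      (\<lambda>z. (2 * max 0 (a - (norm (z - 0))\<^sup>2)) *\<^sub>R (0 - 2 *\<^sub>R (z - 0)))"
    by (rule C1_compose[OF _ DERIV_pos_part_sq]) (intro continuous_intros)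
  then show ?thesis
    by (auto simp: bump_def[abs_def])
qed

lemma bump_support:
  assumes "a < 1"
  shows "compact (closure {z. bump a z * p z \<noteq> 0})" "closure {z. bump a z * p z \<noteq> 0} \<subseteq> \<Omega>"
proof -
  define b where "b = max 0 a"
  have "{z. bump a z * p z \<noteq> 0} \<subseteq> cball 0 (sqrt b)"
  proof
    fix z assume "z \<in> {z. bump a z * p z \<noteq> 0}"
    then have "0 < a - (norm z)\<^sup>2"
      by (auto simp: bump_def max_def split: if_splits)
    then have "(norm z)\<^sup>2 \<le> b"
      by (simp add: b_def)
    then show "z \<in> cball 0 (sqrt b)"
      by (simp add: real_le_rsqrt)
  qed
  then have sub: "closure {z. bump a z * p z \<noteq> 0} \<subseteq> cball 0 (sqrt b)"
    by (rule closure_minimal) simp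
  show "compact (closure {z. bump a z * p z \<noteq> 0})"
    using sub by (meson bounded_cball bounded_subset closed_closure compact_eq_bounded_closed)
  have "sqrt b < 1"
    using assms by (simp add: b_def)
  then have "cball 0 (sqrt b) \<subseteq> (\<Omega> :: complex set)"
    by (simp add: cball_subset_ball_iff)
  with sub show "closure {z. bump a z * p z \<noteq> 0} \<subseteq> \<Omega>"
    by blast
qed

text \<open>By Stone-Weierstrass, \<open>h\<close> times a cutoff is orthogonal to all continuous functions, hence to the
  limit \<open>sgn h\<close> of bounded continuous functions.\<close>

lemma disk_fundamental_lemma:
  fixes h :: "complex \<Rightarrow> real"
  assumes h: "integrable (lebesgue_on \<Omega>) h"
    and test: "\<And>\<phi> \<Phi>. C1_with_gradient \<phi> \<Phi> \<Longrightarrow> compact (closure {x. \<phi> x \<noteq> 0}) \<Longrightarrow>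
      closure {x. \<phi> x \<noteq> 0} \<subseteq> \<Omega> \<Longrightarrow> (\<integral>x. \<phi> x * h x \<partial>lebesgue_on \<Omega>) = 0"
  shows "AE x in lebesgue_on \<Omega>. h x = 0"
proof -
  let ?M = "lebesgue_on \<Omega>"
  have mh: "h \<in> borel_measurable ?M"
    using h by auto
  have cb: "continuous_on UNIV (bump a)" for a
    using C1_bump continuous_on_C1(1) by blast
  have mb: "bump a \<in> borel_measurable ?M" for a
    by (intro continuous_on_borel_measurable_lebesgue_on cb)
  have b01: "0 \<le> bump a x" "a < 1 \<Longrightarrow> bump a x \<le> 1" for a x
  proof -
    show "0 \<le> bump a x"
      by (simp add: bump_def)
    show "bump a x \<le> 1" if "a < 1"
    proof -
      have "max 0 (a - (norm x)\<^sup>2) \<le> 1"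
        using that zero_le_power2[of "norm x"] by linarith
      then show ?thesis
        by (simp add: bump_def power_le_one)
    qed
  qed
  have ib: "integrable ?M (\<lambda>x. bump a x * g x * h x)"
    if g: "g \<in> borel_measurable ?M" "\<And>x. x \<in> \<Omega> \<Longrightarrow> \<bar>g x\<bar> \<le> B" and "a < 1" for a g B
  proof (rule Bochner_Integration.integrable_bound)
    show "integrable ?M (\<lambda>x. B * \<bar>h x\<bar>)"
      using h by simp
    show "(\<lambda>x. bump a x * g x * h x) \<in> borel_measurable ?M"
      by (intro borel_measurable_times mb g mh)
    show "AE x in ?M. norm (bump a x * g x * h x) \<le> norm (B * \<bar>h x\<bar>)"
    proof (rule AE_I2)
      fix x assume "x \<in> space ?M"
      then have gB: "\<bar>g x\<bar> \<le> B" using g(2) by simp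
      have "bump a x * \<bar>g x\<bar> \<le> 1 * B"
        using b01[of a x] \<open>a < 1\<close> gB by (intro mult_mono) auto
      then show "norm (bump a x * g x * h x) \<le> norm (B * \<bar>h x\<bar>)"
        using b01(1)[of a x] gB by (auto simp: abs_mult intro!: mult_right_mono)
    qed
  qed
  have poly: "(\<integral>x. bump a x * p x * h x \<partial>?M) = 0" if p: "real_polynomial_function p" and a: "a < 1" for p a
  proof -
    obtain B P where "C1_with_gradient (bump a) B" "C1_with_gradient p P"
      using C1_bump C1_real_polynomial[OF p] by blast
    then show ?thesis
      by (intro test[OF C1_mult] bump_support a)
  qed
  have cont: "(\<integral>x. bump a x * g x * h x \<partial>?M) = 0" if g: "continuous_on UNIV g" and a: "a < 1" for g a
  proof (rule ccontr)
    assume ne: "(\<integral>x. bump a x * g x * h x \<partial>?M) \<noteq> 0" (is "?I \<noteq> 0")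
    define A where "A = (\<integral>x. \<bar>h x\<bar> \<partial>?M)"
    have A: "A \<ge> 0" unfolding A_def by (intro Bochner_Integration.integral_nonneg) auto
    \<comment> \<open>Replacing g by a polynomial within e changes the integral by at most e times
      the L1 norm \<open>A\<close> of h, which this choice keeps below the supposed nonzero
      value.\<close>
    define e where "e = \<bar>?I\<bar> / (A + 1)"
    have e: "e > 0" using ne A by (simp add: e_def add_nonneg_pos)
    obtain p where p: "real_polynomial_function p" "\<And>x. x \<in> cball 0 1 \<Longrightarrow> \<bar>g x - p x\<bar> < e"
      using Stone_Weierstrass_real_polynomial_function[of "cball 0 1" g e] e g
        continuous_on_subset by (metis compact_cball subset_UNIV)
    have cp: "continuous_on UNIV p"
      using p(1) by (simp add: continuous_on_polymonial_function real_polynomial_function_eq)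
    have bd: "\<exists>B. \<forall>x\<in>\<Omega>. \<bar>f x\<bar> \<le> B" if "continuous_on UNIV f" for f :: "complex \<Rightarrow> real"
    proof -
      have "bounded (f ` cball 0 1)"
        by (intro compact_imp_bounded compact_continuous_image continuous_on_subset[OF that]) auto
      then show ?thesis
        unfolding bounded_iff using ball_subset_cball by fastforce
    qed
    have ic: "integrable ?M (\<lambda>x. bump a x * f x * h x)" if "continuous_on UNIV f" for f
      using bd[OF that] ib[OF continuous_on_borel_measurable_lebesgue_on[OF that] _ a] by blast
    have "?I = (\<integral>x. bump a x * g x * h x \<partial>?M) - (\<integral>x. bump a x * p x * h x \<partial>?M)"
      using poly[OF p(1) a] by simp
    also have "\<dots> = (\<integral>x. bump a x * (g x - p x) * h x \<partial>?M)"
      using ic[OF g] ic[OF cp] by (simp add: algebra_simps)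
    also have "\<bar>\<dots>\<bar> \<le> (\<integral>x. e * \<bar>h x\<bar> \<partial>?M)"
      unfolding real_norm_def[symmetric]
    proof (rule order.trans[OF integral_norm_bound], rule Bochner_Integration.integral_mono)
      show "integrable ?M (\<lambda>x. norm (bump a x * (g x - p x) * h x))"
        using ic[of "\<lambda>x. g x - p x"] g cp by (simp add: continuous_on_diff)
      show "integrable ?M (\<lambda>x. e * norm (h x))"
        using h by simp
      fix x assume "x \<in> space ?M"
      then have "\<bar>g x - p x\<bar> \<le> e" using p(2)[of x] by simp
      then have "bump a x * \<bar>g x - p x\<bar> \<le> 1 * e"
        using b01[of a x] a by (intro mult_mono) auto
      then show "norm (bump a x * (g x - p x) * h x) \<le> e * norm (h x)"
        using b01(1)[of a x] by (auto simp: abs_mult intro!: mult_right_mono)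
    qed
    also have "\<dots> = e * A" by (simp add: A_def)
    also have "\<dots> < \<bar>?I\<bar>"
    proof -
      have "e * (A + 1) = \<bar>?I\<bar>" using A by (simp add: e_def)
      with e show ?thesis by (simp add: algebra_simps)
    qed
    finally show False by simp
  qed
  have "(\<lambda>x. sgn (h x)) \<in> borel_measurable ?M"
    using mh by measurable
  then have "(\<lambda>x. sgn (h x)) measurable_on \<Omega>"
    by (subst measurable_on_iff_borel_measurable) auto
  then obtain N G where N: "negligible N" and cG: "\<And>n. continuous_on UNIV (G n)"
    and G: "\<And>x. x \<notin> N \<Longrightarrow> (\<lambda>n. G n x) \<longlonglongrightarrow> (if x \<in> \<Omega> then sgn (h x) else 0)"
    unfolding measurable_on_def by blast
  \<comment> \<open>Truncation keeps the limit, because \<open>sgn (h x)\<close> lies in [-1, 1],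
    and lets \<bar>h\<bar> dominate.\<close>
  define C where "C n x = max (-1) (min 1 (G n x))" for n x
  have cC: "continuous_on UNIV (C n)" for n
    unfolding C_def[abs_def] by (intro continuous_intros cG)
  have N_AE: "AE x in ?M. x \<notin> N"
  proof -
    have "N \<in> null_sets lebesgue" using N negligible_iff_null_sets by blast
    then have "AE x in lebesgue. x \<notin> N" by (rule AE_not_in)
    then show ?thesis by (subst AE_restrict_space_iff) auto
  qed
  have zero: "AE x in ?M. bump a x * \<bar>h x\<bar> = 0" if a: "a < 1" for a
  proof -
    have "(\<lambda>n. \<integral>x. bump a x * C n x * h x \<partial>?M) \<longlonglongrightarrow> (\<integral>x. bump a x * \<bar>h x\<bar> \<partial>?M)"
    proof (rule integral_dominated_convergence[where w="\<lambda>x. \<bar>h x\<bar>"])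
      show "AE x in ?M. (\<lambda>n. bump a x * C n x * h x) \<longlonglongrightarrow> bump a x * \<bar>h x\<bar>"
        using N_AE AE_space
      proof eventually_elim
        case (elim x)
        then have "(\<lambda>n. G n x) \<longlonglongrightarrow> sgn (h x)" using G[of x] by simp
        then have "(\<lambda>n. bump a x * C n x * h x) \<longlonglongrightarrow> bump a x * max (-1) (min 1 (sgn (h x))) * h x"
          unfolding C_def by (intro tendsto_intros)
        moreover have "max (-1) (min 1 (sgn (h x))) * h x = \<bar>h x\<bar>"
          by (simp add: sgn_real_def)
        ultimately show ?case by (simp add: mult.assoc)
      qed
      show "AE x in ?M. norm (bump a x * C n x * h x) \<le> \<bar>h x\<bar>" for n
      proof (rule AE_I2)
        fix x
        have "bump a x * \<bar>C n x\<bar> \<le> 1 * 1"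
          using b01[of a x] a by (intro mult_mono) (auto simp: C_def)
        from mult_right_mono[OF this, of "\<bar>h x\<bar>"] show "norm (bump a x * C n x * h x) \<le> \<bar>h x\<bar>"
          using b01(1)[of a x] by (simp add: abs_mult)
      qed
      show "(\<lambda>x. bump a x * C n x * h x) \<in> borel_measurable ?M" for n
        by (intro borel_measurable_times mb mh continuous_on_borel_measurable_lebesgue_on cC)
      show "(\<lambda>x. bump a x * \<bar>h x\<bar>) \<in> borel_measurable ?M"
        by (intro borel_measurable_times borel_measurable_abs mb mh)
    qed (use h in simp)
    then have "(\<integral>x. bump a x * \<bar>h x\<bar> \<partial>?M) = 0"
      using cont[OF cC a] by (simp add: LIMSEQ_const_iff)
    moreover have "integrable ?M (\<lambda>x. bump a x * sgn (h x) * h x)"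
      by (rule ib[where B=1]) (use mh a in \<open>auto simp: sgn_real_def\<close>)
    then have "integrable ?M (\<lambda>x. bump a x * \<bar>h x\<bar>)"
      by (simp add: abs_sgn mult_ac)
    ultimately show ?thesis
      using b01(1) by (subst (asm) integral_nonneg_eq_0_iff_AE) auto
  qed
  \<comment> \<open>These levels are below 1 and tend to 1, so each point of the open disk has a
    positive cutoff for some k; there are countably many, so one null set serves them all.\<close>
  have "AE x in ?M. \<forall>k::nat. bump (1 - 1 / (real k + 2)) x * \<bar>h x\<bar> = 0"
    unfolding AE_all_countable by (intro allI zero) simp
  with AE_space show ?thesis
  proof eventually_elim
    case (elim x)
    then have "0 < 1 - (norm x)\<^sup>2" by (simp add: abs_square_less_1)
    then obtain k where k: "1 / real (Suc k) < 1 - (norm x)\<^sup>2"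
      using nat_approx_posE by blast
    moreover have "1 / (real k + 2) \<le> 1 / real (Suc k)"
      by (simp add: field_simps)
    ultimately have "0 < (1 - 1 / (real k + 2)) - (norm x)\<^sup>2" by linarith
    then have "bump (1 - 1 / (real k + 2)) x \<noteq> 0"
      by (simp add: bump_def)
    with elim(2) show "h x = 0" by auto
  qed
qed

text \<open>The difference of two weak gradients is orthogonal to every test function. The
  fundamental lemma is scalar and is applied to the real and imaginary parts.\<close>

lemma weak_gradient_unique:
  assumes "G \<in> L2 (lebesgue_on \<Omega>)" "has_weak_gradient u G"
    and "G' \<in> L2 (lebesgue_on \<Omega>)" "has_weak_gradient u G'"
  shows "AE x in lebesgue_on \<Omega>. G x = G' x"
proof -
  define H where "H x = G x - G' x" for x
  have H: "H \<in> L2 (lebesgue_on \<Omega>)"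
    unfolding H_def using assms by (intro L2_diff)
  have one: "(\<lambda>x. 1::real) \<in> L2 (lebesgue_on \<Omega>)"
    by (intro continuous_L2_disk continuous_intros)
  have iH: "integrable (lebesgue_on \<Omega>) H"
    using L2_scaleR_integrable[OF one H] by simp
  have test: "(\<integral>x. \<phi> x *\<^sub>R H x \<partial>lebesgue_on \<Omega>) = 0" "integrable (lebesgue_on \<Omega>) (\<lambda>x. \<phi> x *\<^sub>R H x)"
    if "C1_with_gradient \<phi> \<Phi>" "compact (closure {x. \<phi> x \<noteq> 0})" "closure {x. \<phi> x \<noteq> 0} \<subseteq> \<Omega>" for \<phi> \<Phi>
  proof -
    have "- (\<integral>x. \<phi> x *\<^sub>R G x \<partial>lebesgue_on \<Omega>) = - (\<integral>x. \<phi> x *\<^sub>R G' x \<partial>lebesgue_on \<Omega>)"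
      using assms(2)[unfolded has_weak_gradient_def, rule_format, OF that]
        assms(4)[unfolded has_weak_gradient_def, rule_format, OF that] by (rule trans[OF sym])
    then show "(\<integral>x. \<phi> x *\<^sub>R H x \<partial>lebesgue_on \<Omega>) = 0"
      using L2_scaleR_integrable[OF C1_L2_disk(1)[OF that(1)] assms(1)]
        L2_scaleR_integrable[OF C1_L2_disk(1)[OF that(1)] assms(3)]
      by (simp add: H_def scaleR_diff_right)
    show "integrable (lebesgue_on \<Omega>) (\<lambda>x. \<phi> x *\<^sub>R H x)"
      by (rule L2_scaleR_integrable[OF C1_L2_disk(1)[OF that(1)] H])
  qed
  have "AE x in lebesgue_on \<Omega>. Re (H x) = 0"
  proof (rule disk_fundamental_lemma)
    fix \<phi> \<Phi> assume *: "C1_with_gradient \<phi> \<Phi>" "compact (closure {x. \<phi> x \<noteq> 0})" "closure {x. \<phi> x \<noteq> 0} \<subseteq> \<Omega>"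
    show "(\<integral>x. \<phi> x * Re (H x) \<partial>lebesgue_on \<Omega>) = 0"
      using integral_Re[OF test(2)[OF *]] test(1)[OF *] by simp
  qed (use iH in simp)
  moreover have "AE x in lebesgue_on \<Omega>. Im (H x) = 0"
  proof (rule disk_fundamental_lemma)
    fix \<phi> \<Phi> assume *: "C1_with_gradient \<phi> \<Phi>" "compact (closure {x. \<phi> x \<noteq> 0})" "closure {x. \<phi> x \<noteq> 0} \<subseteq> \<Omega>"
    show "(\<integral>x. \<phi> x * Im (H x) \<partial>lebesgue_on \<Omega>) = 0"
      using integral_Im[OF test(2)[OF *]] test(1)[OF *] by simp
  qed (use iH in simp)
  ultimately show ?thesis
    by eventually_elim (simp add: H_def complex_eq_iff)
qed

section \<open>The chosen representative of the weak gradient\<close>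

lemma grad_H1:
  assumes "u \<in> H1"
  shows "grad u \<in> L2 (lebesgue_on \<Omega>)" "has_weak_gradient u (grad u)"
proof -
  have "\<exists>G. G \<in> L2 (lebesgue_on \<Omega>) \<and> has_weak_gradient u G"
    using assms unfolding H1_def by blast
  from someI_ex[OF this] show "grad u \<in> L2 (lebesgue_on \<Omega>)" "has_weak_gradient u (grad u)"
    unfolding grad_def by blast+
qed

lemma H1_L2: "u \<in> H1 \<Longrightarrow> u \<in> L2 (lebesgue_on \<Omega>)"
  by (simp add: H1_def)

lemma grad_eqI:
  assumes "u \<in> L2 (lebesgue_on \<Omega>)" "G \<in> L2 (lebesgue_on \<Omega>)" "has_weak_gradient u G"
  shows "u \<in> H1" "AE x in lebesgue_on \<Omega>. grad u x = G x"
proof -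
  show "u \<in> H1" using assms by (auto simp: H1_def)
  then show "AE x in lebesgue_on \<Omega>. grad u x = G x"
    by (intro weak_gradient_unique[where u=u] grad_H1 assms)
qed

lemma has_weak_gradient_diff:
  assumes u: "u \<in> L2 (lebesgue_on \<Omega>)" "G \<in> L2 (lebesgue_on \<Omega>)" "has_weak_gradient u G"
    and v: "v \<in> L2 (lebesgue_on \<Omega>)" "H \<in> L2 (lebesgue_on \<Omega>)" "has_weak_gradient v H"
  shows "has_weak_gradient (\<lambda>x. u x - v x) (\<lambda>x. G x - H x)"
  unfolding has_weak_gradient_def
proof (intro allI impI)
  fix \<phi> \<Phi> assume \<phi>: "C1_with_gradient \<phi> \<Phi>" "compact (closure {x. \<phi> x \<noteq> 0})" "closure {x. \<phi> x \<noteq> 0} \<subseteq> \<Omega>"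
  have "(\<integral>x. u x *\<^sub>R \<Phi> x \<partial>lebesgue_on \<Omega>) = - (\<integral>x. \<phi> x *\<^sub>R G x \<partial>lebesgue_on \<Omega>)"
    "(\<integral>x. v x *\<^sub>R \<Phi> x \<partial>lebesgue_on \<Omega>) = - (\<integral>x. \<phi> x *\<^sub>R H x \<partial>lebesgue_on \<Omega>)"
    using u(3) v(3) \<phi> unfolding has_weak_gradient_def by blast+
  then show "(\<integral>x. (u x - v x) *\<^sub>R \<Phi> x \<partial>lebesgue_on \<Omega>) = - (\<integral>x. \<phi> x *\<^sub>R (G x - H x) \<partial>lebesgue_on \<Omega>)"
    using L2_scaleR_integrable[OF u(1) C1_L2_disk(2)[OF \<phi>(1)]] L2_scaleR_integrable[OF v(1) C1_L2_disk(2)[OF \<phi>(1)]]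
      L2_scaleR_integrable[OF C1_L2_disk(1)[OF \<phi>(1)] u(2)] L2_scaleR_integrable[OF C1_L2_disk(1)[OF \<phi>(1)] v(2)]
    by (simp add: scaleR_diff_left scaleR_diff_right)
qed

lemma grad_diff:
  assumes "u \<in> H1" "v \<in> H1"
  shows "(\<lambda>x. u x - v x) \<in> H1" "AE x in lebesgue_on \<Omega>. grad (\<lambda>x. u x - v x) x = grad u x - grad v x"
proof -
  note uv = H1_L2[OF assms(1)] grad_H1[OF assms(1)] H1_L2[OF assms(2)] grad_H1[OF assms(2)]
  note * = L2_diff[OF uv(1,4)] L2_diff[OF uv(2,5)] has_weak_gradient_diff[OF uv]
  show "(\<lambda>x. u x - v x) \<in> H1"
    by (rule grad_eqI(1)[OF *])
  show "AE x in lebesgue_on \<Omega>. grad (\<lambda>x. u x - v x) x = grad u x - grad v x"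
    by (rule grad_eqI(2)[OF *])
qed

section \<open>Traces on the circle\<close>

lemma finite_measure_circle: "finite_measure (lebesgue_on {0..2*pi})"
  by (rule finite_measure_lebesgue_on) simp

lemma continuous_L2_circle:
  assumes "continuous_on UNIV f"
  shows "(\<lambda>t. f (cis t) :: real) \<in> L2 (lebesgue_on {0..2*pi})"
proof -
  have "bounded (f ` cball 0 1)"
    by (intro compact_imp_bounded compact_continuous_image continuous_on_subset[OF assms]) auto
  then obtain B where "\<And>z. z \<in> cball 0 1 \<Longrightarrow> norm (f z) \<le> B"
    unfolding bounded_iff by blast
  then show ?thesis
    by (intro L2_bounded[where B=B] finite_measure_circle continuous_on_borel_measurable_lebesgue_on
        continuous_on_compose2[OF assms] continuous_intros) auto
qed

text \<open>The approximating sequences may be subtracted. The purpose is that two functions with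
  the same trace differ by an element of \<open>H1_0\<close>.\<close>

lemma has_trace_diff:
  assumes "has_trace u g" "has_trace v h"
  shows "has_trace (\<lambda>x. u x - v x) (\<lambda>t. g t - h t)"
proof -
  have H: "u \<in> H1" "v \<in> H1" and gh: "g \<in> L2_circle" "h \<in> L2_circle"
    using assms by (auto simp: has_trace_def)
  obtain \<phi> \<Phi> where \<phi>: "\<And>n. C1_with_gradient (\<phi> n) (\<Phi> n)" "tendsto_L2 (lebesgue_on \<Omega>) \<phi> u"
    "tendsto_L2 (lebesgue_on \<Omega>) \<Phi> (grad u)" "tendsto_L2 (lebesgue_on {0..2*pi}) (\<lambda>n t. \<phi> n (cis t)) g"
    using assms(1) unfolding has_trace_def by blast
  obtain \<psi> \<Psi> where \<psi>: "\<And>n. C1_with_gradient (\<psi> n) (\<Psi> n)" "tendsto_L2 (lebesgue_on \<Omega>) \<psi> v"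
    "tendsto_L2 (lebesgue_on \<Omega>) \<Psi> (grad v)" "tendsto_L2 (lebesgue_on {0..2*pi}) (\<lambda>n t. \<psi> n (cis t)) h"
    using assms(2) unfolding has_trace_def by blast
  note L2s = C1_L2_disk[OF \<phi>(1)] C1_L2_disk[OF \<psi>(1)] H1_L2[OF H(1)] H1_L2[OF H(2)]
    grad_H1(1)[OF H(1)] grad_H1(1)[OF H(2)]
  have 1: "C1_with_gradient (\<lambda>x. \<phi> n x - \<psi> n x) (\<lambda>x. \<Phi> n x - \<Psi> n x)" for n
    by (intro C1_diff \<phi> \<psi>)
  have 2: "tendsto_L2 (lebesgue_on \<Omega>) (\<lambda>n x. \<phi> n x - \<psi> n x) (\<lambda>x. u x - v x)"
    by (intro tendsto_L2_diff \<phi> \<psi> L2s)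
  have 3: "tendsto_L2 (lebesgue_on \<Omega>) (\<lambda>n x. \<Phi> n x - \<Psi> n x) (\<lambda>x. grad u x - grad v x)"
    by (intro tendsto_L2_diff \<phi> \<psi> L2s)
  have 4: "tendsto_L2 (lebesgue_on \<Omega>) (\<lambda>n x. \<Phi> n x - \<Psi> n x) (grad (\<lambda>x. u x - v x))"
  \<comment> \<open>The gradient of the difference is chosen separately from those of
    \<open>u\<close> and \<open>v\<close>, hence the passage through almost-everywhere
    equality.\<close>
  proof (rule tendsto_L2_AE_cong[OF _ _ _ _ 3])
    show "AE x in lebesgue_on \<Omega>. grad u x - grad v x = grad (\<lambda>x. u x - v x) x"
      using grad_diff(2)[OF H] by eventually_elim simp
  qed (intro L2D(1) L2_diff L2s grad_H1 grad_diff H)+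
  have 5: "tendsto_L2 (lebesgue_on {0..2*pi}) (\<lambda>n t. \<phi> n (cis t) - \<psi> n (cis t)) (\<lambda>t. g t - h t)"
    using gh by (intro tendsto_L2_diff \<phi> \<psi> continuous_L2_circle continuous_on_C1[OF \<phi>(1)] continuous_on_C1[OF \<psi>(1)])
      (auto simp: L2_circle_def)
  have 6: "(\<lambda>t. g t - h t) \<in> L2_circle"
    using gh by (auto simp: L2_circle_def intro!: L2_diff)
  show ?thesis
    unfolding has_trace_def
    by (intro conjI grad_diff(1)[OF H] 6 exI[of _ "\<lambda>n x. \<phi> n x - \<psi> n x"]
        exI[of _ "\<lambda>n x. \<Phi> n x - \<Psi> n x"] allI 1 2 4 5)
qed

lemma L2_bounded_scaleR:
  fixes f :: "'a \<Rightarrow> 'b::{real_normed_vector, second_countable_topology}"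
  assumes "f \<in> L2 M" "c \<in> borel_measurable M" "\<And>x. \<bar>c x\<bar> \<le> B"
  shows "(\<lambda>x. c x *\<^sub>R f x) \<in> L2 M"
proof -
  have m: "(\<lambda>x. c x *\<^sub>R f x) \<in> borel_measurable M"
    using assms(2) L2D(1)[OF assms(1)] by (rule borel_measurable_scaleR)
  have "integrable M (\<lambda>x. (norm (c x *\<^sub>R f x))\<^sup>2)"
  proof (rule Bochner_Integration.integrable_bound)
    show "integrable M (\<lambda>x. B\<^sup>2 * (norm (f x))\<^sup>2)"
      using L2D(2)[OF assms(1)] by simp
    show "(\<lambda>x. (norm (c x *\<^sub>R f x))\<^sup>2) \<in> borel_measurable M"
      using m by measurable
    have "\<bar>c x\<bar>\<^sup>2 \<le> B\<^sup>2" for x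
      using assms(3) by (intro power_mono) auto
    then show "AE x in M. norm ((norm (c x *\<^sub>R f x))\<^sup>2) \<le> norm (B\<^sup>2 * (norm (f x))\<^sup>2)"
      by (auto intro!: AE_I2 mult_right_mono simp: power_mult_distrib abs_mult)
  qed
  with m show ?thesis by (simp add: L2_def)
qed

section \<open>The energy form and weak solutions\<close>

context
  fixes D :: "complex set" and \<sigma>\<^sub>1 \<sigma>\<^sub>2 :: real
  assumes D: "D \<in> sets borel"
begin

lemma conductivity_grad_L2:
  assumes "u \<in> H1"
  shows "(\<lambda>x. conductivity \<sigma>\<^sub>1 \<sigma>\<^sub>2 D x *\<^sub>R grad u x) \<in> L2 (lebesgue_on \<Omega>)"
proof (rule L2_bounded_scaleR[OF grad_H1(1)[OF assms]])
  have "conductivity \<sigma>\<^sub>1 \<sigma>\<^sub>2 D \<in> borel_measurable borel"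
    unfolding conductivity_def[abs_def] using D by measurable
  then show "conductivity \<sigma>\<^sub>1 \<sigma>\<^sub>2 D \<in> borel_measurable (lebesgue_on \<Omega>)"
    by (simp add: measurable_completion measurable_restrict_space1)
  show "\<bar>conductivity \<sigma>\<^sub>1 \<sigma>\<^sub>2 D x\<bar> \<le> \<bar>\<sigma>\<^sub>1\<bar> + \<bar>\<sigma>\<^sub>2\<bar>" for x
    by (auto simp: conductivity_def indicator_def)
qed

lemma energy_integrable:
  assumes "u \<in> H1" "v \<in> H1"
  shows "integrable (lebesgue_on \<Omega>) (\<lambda>x. conductivity \<sigma>\<^sub>1 \<sigma>\<^sub>2 D x * (grad u x \<bullet> grad v x))"
  using L2_inner_integrable[OF conductivity_grad_L2[OF assms(1)] grad_H1(1)[OF assms(2)]] by simp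

lemma energy_diff_left:
  assumes "u \<in> H1" "u' \<in> H1" "v \<in> H1"
  shows "energy \<sigma>\<^sub>1 \<sigma>\<^sub>2 D (\<lambda>x. u x - u' x) v = energy \<sigma>\<^sub>1 \<sigma>\<^sub>2 D u v - energy \<sigma>\<^sub>1 \<sigma>\<^sub>2 D u' v"
proof -
  have "energy \<sigma>\<^sub>1 \<sigma>\<^sub>2 D u v - energy \<sigma>\<^sub>1 \<sigma>\<^sub>2 D u' v
      = (\<integral>x. conductivity \<sigma>\<^sub>1 \<sigma>\<^sub>2 D x * (grad u x \<bullet> grad v x) - conductivity \<sigma>\<^sub>1 \<sigma>\<^sub>2 D x * (grad u' x \<bullet> grad v x) \<partial>lebesgue_on \<Omega>)"
    unfolding energy_def using energy_integrable assms by simp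
  also have "\<dots> = energy \<sigma>\<^sub>1 \<sigma>\<^sub>2 D (\<lambda>x. u x - u' x) v"
    unfolding energy_def
  proof (rule integral_cong_AE)
    show "AE x in lebesgue_on \<Omega>. conductivity \<sigma>\<^sub>1 \<sigma>\<^sub>2 D x * (grad u x \<bullet> grad v x) - conductivity \<sigma>\<^sub>1 \<sigma>\<^sub>2 D x * (grad u' x \<bullet> grad v x)
        = conductivity \<sigma>\<^sub>1 \<sigma>\<^sub>2 D x * (grad (\<lambda>x. u x - u' x) x \<bullet> grad v x)"
      using grad_diff(2)[OF assms(1,2)] by eventually_elim (simp add: inner_diff_left right_diff_distrib)
  qed (use energy_integrable assms grad_diff(1) in \<open>auto intro!: borel_measurable_integrable borel_measurable_diff\<close>)
  finally show ?thesis by simp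
qed

lemma energy_commute: "energy \<sigma>\<^sub>1 \<sigma>\<^sub>2 D u v = energy \<sigma>\<^sub>1 \<sigma>\<^sub>2 D v u"
  by (simp add: energy_def inner_commute)

text \<open>The difference of the two extensions lies in \<open>H1_0\<close>, where the energy of a
  weak solution vanishes. Hence the choice of extension in \<open>conormal_derivative\<close> is
  immaterial.\<close>

lemma energy_eq_of_trace_eq:
  assumes "weak_solution \<sigma>\<^sub>1 \<sigma>\<^sub>2 D f u" "has_trace v g" "has_trace w g"
  shows "energy \<sigma>\<^sub>1 \<sigma>\<^sub>2 D u v = energy \<sigma>\<^sub>1 \<sigma>\<^sub>2 D u w"
proof -
  have H: "u \<in> H1" "v \<in> H1" "w \<in> H1"
    using assms by (auto simp: weak_solution_def has_trace_def)
  have "(\<lambda>x. v x - w x) \<in> H1_0"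
    using has_trace_diff[OF assms(2,3)] by (simp add: H1_0_def)
  then have "energy \<sigma>\<^sub>1 \<sigma>\<^sub>2 D u (\<lambda>x. v x - w x) = 0"
    using assms(1) by (simp add: weak_solution_def)
  then show ?thesis
    using energy_diff_left[OF H(2,3,1)] by (simp add: energy_commute[of u])
qed

text \<open>Testing with the difference \<open>d\<close> of the solutions, itself in
  \<open>H1_0\<close>, gives it energy zero, so its gradient vanishes almost everywhere. Energies
  see only gradients, hence the choice of solution in \<open>DtN\<close> is immaterial.\<close>

lemma energy_weak_solution_unique:
  assumes "\<sigma>\<^sub>1 > 0" "\<sigma>\<^sub>2 > 0" and u: "weak_solution \<sigma>\<^sub>1 \<sigma>\<^sub>2 D f u" and u': "weak_solution \<sigma>\<^sub>1 \<sigma>\<^sub>2 D f u'"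
    and v: "v \<in> H1"
  shows "energy \<sigma>\<^sub>1 \<sigma>\<^sub>2 D u v = energy \<sigma>\<^sub>1 \<sigma>\<^sub>2 D u' v"
proof -
  define d where "d x = u x - u' x" for x
  have H: "u \<in> H1" "u' \<in> H1"
    using u u' by (auto simp: weak_solution_def)
  have dH: "d \<in> H1"
    unfolding d_def[abs_def] by (intro grad_diff H)
  have d0: "d \<in> H1_0"
    using has_trace_diff[of u f u' f] u u' by (simp add: d_def[abs_def] H1_0_def weak_solution_def)
  have "energy \<sigma>\<^sub>1 \<sigma>\<^sub>2 D d d = 0"
    using energy_diff_left[OF H dH] u u' d0 by (simp add: weak_solution_def d_def[abs_def])
  moreover have pos: "conductivity \<sigma>\<^sub>1 \<sigma>\<^sub>2 D x > 0" for x
    using assms(1,2) by (auto simp: conductivity_def indicator_def)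
  ultimately have "AE x in lebesgue_on \<Omega>. conductivity \<sigma>\<^sub>1 \<sigma>\<^sub>2 D x * (grad d x \<bullet> grad d x) = 0"
    unfolding energy_def using energy_integrable[OF dH dH] less_imp_le[OF pos]
    by (subst (asm) integral_nonneg_eq_0_iff_AE) auto
  then have "AE x in lebesgue_on \<Omega>. conductivity \<sigma>\<^sub>1 \<sigma>\<^sub>2 D x * (grad d x \<bullet> grad v x) = 0"
    by eventually_elim (use pos in \<open>auto simp: less_le\<close>)
  then have "energy \<sigma>\<^sub>1 \<sigma>\<^sub>2 D d v = 0"
    unfolding energy_def by (rule integral_eq_zero_AE)
  then show ?thesis
    using energy_diff_left[OF H v] unfolding d_def[abs_def] by linarith
qed

end

section \<open>Explicit potentials for a disk\<close>

text \<open>\<open>Z\<close> is the gradient of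
  \<open>Re (f z) * h ((norm (z - c))\<^sup>2)\<close>, and a rotated gradient has divergence zero.
  So the divergence of \<open>\<phi> z *\<^sub>R (- \<i> * Z z)\<close> is the integrand on the
  left, and the right side is its outward flux. The second derivatives make \<open>Z\<close> itself
  C1, as the divergence theorem requires.\<close>

lemma green_stream_function:
  fixes f f' f'' :: "complex \<Rightarrow> complex" and h h' h'' :: "real \<Rightarrow> real" and c :: complex
  defines "Z \<equiv> (\<lambda>z. h ((norm (z - c))\<^sup>2) *\<^sub>R cnj (f' z) + (2 * Re (f z) * h' ((norm (z - c))\<^sup>2)) *\<^sub>R (z - c))"
  assumes f: "\<And>z. (f has_field_derivative f' z) (at z)" "\<And>z. (f' has_field_derivative f'' z) (at z)"
      "continuous_on UNIV f''"
    and h: "\<And>s. (h has_real_derivative h' s) (at s)" "\<And>s. (h' has_real_derivative h'' s) (at s)"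
      "continuous_on UNIV h''"
    and \<phi>: "C1_with_gradient \<phi> \<Phi>"
  shows "(\<integral>z. \<Phi> z \<bullet> (- \<i> * Z z) \<partial>lebesgue_on \<Omega>)
    = (\<integral>t. \<phi> (cis t) * ((- \<i> * Z (cis t)) \<bullet> cis t) \<partial>lebesgue_on {0..2*pi})"
proof -
  define s where "s z = (norm (z - c))\<^sup>2" for z
  \<comment> \<open>A and B are \<open>Im Z\<close> and \<open>Re Z\<close>, so the rotated field
    \<open>- \<i> * Z\<close> has the components A and - B.\<close>
  define A where "A z = 2 * Re (f z) * h' (s z) * Im (z - c) - h (s z) * Im (f' z)" for z
  define B where "B z = 2 * Re (f z) * h' (s z) * Re (z - c) + h (s z) * Re (f' z)" for z
  have cf': "continuous_on UNIV f'"
    using f(2) by (meson DERIV_isCont continuous_at_imp_continuous_on)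
  have ch': "continuous_on UNIV h'"
    using h(2) by (meson DERIV_isCont continuous_at_imp_continuous_on)
  have s: "C1_with_gradient s (\<lambda>z. 2 *\<^sub>R (z - c))"
    unfolding s_def[abs_def] by (rule C1_norm_sq)
  have lin: "((\<lambda>z. z - c) has_field_derivative 1) (at z)" for z :: complex
    by (auto intro!: derivative_eq_intros)
  note gs = C1_compose[OF s h(1) ch'] C1_compose[OF s h(2,3)] C1_Re_holomorphic[OF f(1) cf']
    C1_Re_holomorphic[OF f(2,3)] C1_Im_holomorphic[OF f(2,3)]
    C1_Re_holomorphic[OF lin continuous_on_const] C1_Im_holomorphic[OF lin continuous_on_const]
  note A = C1_diff[OF C1_mult[OF C1_mult[OF C1_mult[OF C1_const[of 2] gs(3)] gs(2)] gs(7)] C1_mult[OF gs(1) gs(5)],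
      folded A_def]
  note B = C1_add[OF C1_mult[OF C1_mult[OF C1_mult[OF C1_const[of 2] gs(3)] gs(2)] gs(6)] C1_mult[OF gs(1) gs(4)],
      folded B_def]
  \<comment> \<open>The gradients are left as unknowns that \<open>A\<close> and \<open>B\<close>
    fill in; what remains is the equality of the mixed second derivatives.\<close>
  have "\<exists>A' B'. C1_with_gradient A A' \<and> C1_with_gradient B B' \<and> (\<forall>z. Re (A' z) = Im (B' z))"
    by (rule exI, rule exI, rule conjI, rule A, rule conjI, rule B) (simp add: algebra_simps)
  then obtain A' B' where A': "C1_with_gradient A A'" and B': "C1_with_gradient B B'"
    and div0: "\<And>z. Re (A' z) = Im (B' z)"
    by blast
  have ZA: "Im (Z z) = A z" and ZB: "Re (Z z) = B z" for z
    by (simp_all add: Z_def A_def B_def s_def)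
  have inn: "w \<bullet> (- \<i> * Z z) = Re w * A z - Im w * B z" for w z
    by (simp add: inner_complex_def ZA ZB algebra_simps)
  note mA = C1_mult[OF \<phi> A'] and mB = C1_mult[OF \<phi> B']
  have iA: "integrable (lebesgue_on \<Omega>) (\<lambda>z. Re (\<phi> z *\<^sub>R A' z + A z *\<^sub>R \<Phi> z))"
    by (intro integrable_Re Bochner_Integration.integrable_add L2_scaleR_integrable C1_L2_disk[OF \<phi>] C1_L2_disk[OF A'])
  have iB: "integrable (lebesgue_on \<Omega>) (\<lambda>z. Im (\<phi> z *\<^sub>R B' z + B z *\<^sub>R \<Phi> z))"
    by (intro integrable_Im Bochner_Integration.integrable_add L2_scaleR_integrable C1_L2_disk[OF \<phi>] C1_L2_disk[OF B'])
  have "(\<integral>z. \<Phi> z \<bullet> (- \<i> * Z z) \<partial>lebesgue_on \<Omega>)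
      = (\<integral>z. Re (\<phi> z *\<^sub>R A' z + A z *\<^sub>R \<Phi> z) - Im (\<phi> z *\<^sub>R B' z + B z *\<^sub>R \<Phi> z) \<partial>lebesgue_on \<Omega>)"
  proof -
    have "\<Phi> z \<bullet> (- \<i> * Z z) = Re (\<phi> z *\<^sub>R A' z + A z *\<^sub>R \<Phi> z) - Im (\<phi> z *\<^sub>R B' z + B z *\<^sub>R \<Phi> z)" for z
      unfolding inn by (simp add: div0)
    then show ?thesis by simp
  qed
  also have "\<dots> = (\<integral>t. \<phi> (cis t) * A (cis t) * cos t \<partial>lebesgue_on {0..2*pi})
      - (\<integral>t. \<phi> (cis t) * B (cis t) * sin t \<partial>lebesgue_on {0..2*pi})"
    by (subst Bochner_Integration.integral_diff[OF iA iB])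
      (simp only: disk_divergence_Re[OF mA] disk_divergence_Im[OF mB])
  also have "\<dots> = (\<integral>t. \<phi> (cis t) * A (cis t) * cos t - \<phi> (cis t) * B (cis t) * sin t \<partial>lebesgue_on {0..2*pi})"
  proof (rule Bochner_Integration.integral_diff[symmetric])
    have *: "integrable (lebesgue_on {0..2*pi}) g" if "continuous_on UNIV g" for g :: "real \<Rightarrow> real"
      using that continuous_on_subset by (blast intro: continuous_imp_integrable_real)
    note c = continuous_on_compose2[OF continuous_on_C1(1)[OF \<phi>, of UNIV]]
      continuous_on_compose2[OF continuous_on_C1(1)[OF A', of UNIV]]
      continuous_on_compose2[OF continuous_on_C1(1)[OF B', of UNIV]]
    show "integrable (lebesgue_on {0..2*pi}) (\<lambda>t. \<phi> (cis t) * A (cis t) * cos t)"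
      "integrable (lebesgue_on {0..2*pi}) (\<lambda>t. \<phi> (cis t) * B (cis t) * sin t)"
      by (auto intro!: * continuous_intros c)
  qed
  also have "\<dots> = (\<integral>t. \<phi> (cis t) * ((- \<i> * Z (cis t)) \<bullet> cis t) \<partial>lebesgue_on {0..2*pi})"
  proof -
    have "\<phi> (cis t) * A (cis t) * cos t - \<phi> (cis t) * B (cis t) * sin t
        = \<phi> (cis t) * ((- \<i> * Z (cis t)) \<bullet> cis t)" for t
      unfolding inner_commute[of _ "cis t"] inn by (simp add: algebra_simps)
    then show ?thesis by simp
  qed
  finally show ?thesis .
qed

text \<open>A regularization of \<open>max s q\<close>; for \<open>e = 0\<close> it is the maximum itself, and \<open>softmax' q 0 q = 1/2\<close>
  since division by zero gives zero.\<close>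

definition softmax :: "real \<Rightarrow> real \<Rightarrow> real \<Rightarrow> real" where
  "softmax q e s = (s + q + sqrt ((s - q)\<^sup>2 + e)) / 2"

definition softmax' :: "real \<Rightarrow> real \<Rightarrow> real \<Rightarrow> real" where
  "softmax' q e s = (1 + (s - q) / sqrt ((s - q)\<^sup>2 + e)) / 2"

text \<open>Here s stands for the squared distance to the centre, q for the squared radius and
  \<open>Suc m\<close> for the exponent n. As \<open>softmax q 0 s\<close> is the maximum, the value
  for \<open>e = 0\<close> is 1 + \<kappa> inside the disk and
  \<open>1 + \<kappa> * (q / s) ^ Suc m\<close> outside: a single formula for both regions, which
  can be smoothed.\<close>

definition profile :: "nat \<Rightarrow> real \<Rightarrow> real \<Rightarrow> real \<Rightarrow> real \<Rightarrow> real" where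
  "profile m \<kappa> q e s = 1 + \<kappa> * (q / softmax q e s) ^ Suc m"

definition profile' :: "nat \<Rightarrow> real \<Rightarrow> real \<Rightarrow> real \<Rightarrow> real \<Rightarrow> real" where
  "profile' m \<kappa> q e s = - \<kappa> * real (Suc m) * ((q / softmax q e s) ^ Suc m / softmax q e s) * softmax' q e s"

definition potential :: "nat \<Rightarrow> real \<Rightarrow> real \<Rightarrow> complex \<Rightarrow> complex \<Rightarrow> real \<Rightarrow> complex \<Rightarrow> real" where
  "potential m \<kappa> q c \<alpha> e z = Re (\<alpha> * (z - c) ^ Suc m) * profile m \<kappa> q e ((norm (z - c))\<^sup>2)"

text \<open>The product rule for \<open>potential\<close>, where \<open>2 *\<^sub>R (z - c)\<close>
  is the gradient of the squared distance. For \<open>e = 0\<close> it has a value on the circle of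
  radius \<open>sqrt q\<close> too, namely the pointwise limit of the smoothed gradients.\<close>

definition potential_grad :: "nat \<Rightarrow> real \<Rightarrow> real \<Rightarrow> complex \<Rightarrow> complex \<Rightarrow> real \<Rightarrow> complex \<Rightarrow> complex" where
  "potential_grad m \<kappa> q c \<alpha> e z =
     profile m \<kappa> q e ((norm (z - c))\<^sup>2) *\<^sub>R cnj (of_nat (Suc m) * \<alpha> * (z - c) ^ m)
     + (2 * Re (\<alpha> * (z - c) ^ Suc m) * profile' m \<kappa> q e ((norm (z - c))\<^sup>2)) *\<^sub>R (z - c)"

section \<open>Derivatives, uniform bounds and limits of the smoothed potentials\<close>

lemma softmax_ge:
  assumes "e \<ge> 0"
  shows "s \<le> softmax q e s" "q \<le> softmax q e s"
proof -
  have "\<bar>s - q\<bar> \<le> sqrt ((s - q)\<^sup>2 + e)"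
    using assms by (intro real_le_rsqrt) simp
  then show "s \<le> softmax q e s" "q \<le> softmax q e s"
    by (auto simp: softmax_def)
qed

lemma softmax'_bound:
  assumes "e \<ge> 0"
  shows "\<bar>softmax' q e s\<bar> \<le> 1"
proof -
  define w where "w = sqrt ((s - q)\<^sup>2 + e)"
  have "\<bar>s - q\<bar> \<le> w"
    unfolding w_def using assms by (intro real_le_rsqrt) simp
  then have "\<bar>(s - q) / w\<bar> \<le> 1"
    by (auto simp: divide_le_eq_1)
  moreover have "\<bar>(1 + t) / 2\<bar> \<le> 1" if "\<bar>t\<bar> \<le> 1" for t :: real
    using that by (simp add: abs_if split: if_splits)
  ultimately show ?thesis
    unfolding softmax'_def w_def by blast
qed

lemma softmax_zero:
  "s \<le> q \<Longrightarrow> softmax q 0 s = q" "q \<le> s \<Longrightarrow> softmax q 0 s = s"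
  "s < q \<Longrightarrow> softmax' q 0 s = 0" "q < s \<Longrightarrow> softmax' q 0 s = 1"
  by (auto simp: softmax_def softmax'_def field_simps)

text \<open>Because \<open>softmax q e s\<close> is at least q, the quotient
  \<open>q / softmax q e s\<close> lies in [0, 1]. The bounds are free of e and s, so they dominate
  the passage to \<open>e = 0\<close>.\<close>

lemma
  assumes "q > 0" "e \<ge> 0"
  shows profile_bound: "\<bar>profile m \<kappa> q e s\<bar> \<le> 1 + \<bar>\<kappa>\<bar>"
    and profile'_bound: "\<bar>profile' m \<kappa> q e s\<bar> \<le> \<bar>\<kappa>\<bar> * real (Suc m) / q"
proof -
  have M: "q \<le> softmax q e s"
    using softmax_ge[OF assms(2)] by blast
  have p: "0 \<le> (q / softmax q e s) ^ Suc m" "(q / softmax q e s) ^ Suc m \<le> 1"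
    using M assms(1) by (auto intro!: power_le_one simp del: power_Suc)
  have "\<bar>\<kappa> * (q / softmax q e s) ^ Suc m\<bar> \<le> \<bar>\<kappa>\<bar>"
    using p by (simp add: abs_mult mult_left_le del: power_Suc)
  then show "\<bar>profile m \<kappa> q e s\<bar> \<le> 1 + \<bar>\<kappa>\<bar>"
    unfolding profile_def by linarith
  have "(q / softmax q e s) ^ Suc m / softmax q e s \<le> 1 / q"
    using p M assms(1) by (intro frac_le) auto
  then have "\<bar>(q / softmax q e s) ^ Suc m / softmax q e s * softmax' q e s\<bar> \<le> 1 / q * 1"
    unfolding abs_mult using softmax'_bound[OF assms(2)] p M assms(1)
    by (intro mult_mono) (auto simp del: power_Suc)
  then have "\<bar>- \<kappa> * real (Suc m)\<bar> * \<bar>(q / softmax q e s) ^ Suc m / softmax q e s * softmax' q e s\<bar>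
      \<le> \<bar>- \<kappa> * real (Suc m)\<bar> * (1 / q)"
    by (intro mult_left_mono) auto
  then show "\<bar>profile' m \<kappa> q e s\<bar> \<le> \<bar>\<kappa>\<bar> * real (Suc m) / q"
    by (simp add: profile'_def abs_mult mult.assoc del: power_Suc of_nat_Suc)
qed

lemma DERIV_softmax:
  assumes "e > 0"
  shows "(softmax q e has_real_derivative softmax' q e s) (at s)"
proof -
  have "(s - q)\<^sup>2 + e > 0" using assms by (simp add: add_nonneg_pos)
  then show ?thesis
    unfolding softmax_def[abs_def] softmax'_def
    by (auto intro!: derivative_eq_intros simp: field_simps)
qed

lemma DERIV_softmax':
  assumes "e > 0"
  shows "(softmax' q e has_real_derivative e / (2 * ((s - q)\<^sup>2 + e) * sqrt ((s - q)\<^sup>2 + e))) (at s)"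
proof -
  define w where "w = sqrt ((s - q)\<^sup>2 + e)"
  have pos: "(s - q)\<^sup>2 + e > 0" using assms by (simp add: add_nonneg_pos)
  then have w: "w > 0" "w * w = (s - q)\<^sup>2 + e" by (auto simp: w_def)
  have d: "((\<lambda>s. sqrt ((s - q)\<^sup>2 + e)) has_real_derivative (s - q) / w) (at s)"
    using pos w by (auto intro!: derivative_eq_intros simp: w_def field_simps)
  have n: "((\<lambda>s. s - q) has_real_derivative 1) (at s)"
    by (auto intro!: derivative_eq_intros)
  have "sqrt ((s - q)\<^sup>2 + e) \<noteq> 0"
    using w(1) by (simp add: w_def)
  from DERIV_divide[OF n d this]
  have "((\<lambda>s. (s - q) / sqrt ((s - q)\<^sup>2 + e)) has_real_derivative
      (1 * w - (s - q) * ((s - q) / w)) / (w * w)) (at s)"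
    unfolding w_def .
  from DERIV_cdivide[OF DERIV_add[OF DERIV_const[of 1] this], of 2]
  have "((\<lambda>s. (1 + (s - q) / sqrt ((s - q)\<^sup>2 + e)) / 2) has_real_derivative
      ((1 * w - (s - q) * ((s - q) / w)) / (w * w)) / 2) (at s)"
    by simp
  moreover have "((1 * w - (s - q) * ((s - q) / w)) / (w * w)) / 2 = e / (2 * (w * w) * w)"
  proof -
    have "1 * w - (s - q) * ((s - q) / w) = (w * w - (s - q)\<^sup>2) / w"
      using w(1) by (simp add: field_simps power2_eq_square)
    also have "\<dots> = e / w" using w(2) by simp
    finally show ?thesis using w(1) by (simp add: field_simps)
  qed
  ultimately show ?thesis
    unfolding softmax'_def[abs_def] w(2) by (simp add: w_def)
qed

lemma DERIV_profile:
  assumes "q > 0" "e > 0"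
  shows "(profile m \<kappa> q e has_real_derivative profile' m \<kappa> q e s) (at s)"
proof -
  let ?M = "softmax q e" and ?M' = "softmax' q e"
  have M: "?M s \<noteq> 0"
    using softmax_ge(2)[of e q s] assms by simp
  have "((\<lambda>s. ?M s ^ Suc m) has_real_derivative real (Suc m) * ?M s ^ m * ?M' s) (at s)"
    using DERIV_power_Suc[OF DERIV_softmax[OF assms(2), of q s], of m] by (simp add: algebra_simps)
  then have "((\<lambda>s. inverse (?M s ^ Suc m)) has_real_derivative
      - (inverse (?M s ^ Suc m) * (real (Suc m) * ?M s ^ m * ?M' s) * inverse (?M s ^ Suc m))) (at s)"
    by (rule DERIV_inverse') (use M in simp)
  from DERIV_add[OF DERIV_const[of 1] DERIV_cmult[OF this, of "\<kappa> * q ^ Suc m"]]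
  have "((\<lambda>s. 1 + \<kappa> * q ^ Suc m * inverse (?M s ^ Suc m)) has_real_derivative
      0 + \<kappa> * q ^ Suc m * - (inverse (?M s ^ Suc m) * (real (Suc m) * ?M s ^ m * ?M' s) * inverse (?M s ^ Suc m))) (at s)" .
  moreover have "profile m \<kappa> q e = (\<lambda>s. 1 + \<kappa> * q ^ Suc m * inverse (?M s ^ Suc m))"
    by (simp add: profile_def fun_eq_iff power_mult_distrib power_inverse divide_inverse mult.assoc del: power_Suc)
  moreover have "profile' m \<kappa> q e s
      = 0 + \<kappa> * q ^ Suc m * - (inverse (?M s ^ Suc m) * (real (Suc m) * ?M s ^ m * ?M' s) * inverse (?M s ^ Suc m))"
    using M by (simp add: profile'_def power_divide divide_simps)
  ultimately show ?thesis
    by simp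
qed

text \<open>The second derivative is wanted through its existence and continuity: these make the
  smoothed gradient a C1 field, as \<open>green_stream_function\<close> asks.\<close>

lemma DERIV_profile':
  assumes "q > 0" "e > 0"
  obtains p where "\<And>s. (profile' m \<kappa> q e has_real_derivative p s) (at s)" "continuous_on UNIV p"
proof -
  let ?M = "softmax q e" and ?M' = "softmax' q e"
  let ?M'' = "\<lambda>s. e / (2 * ((s - q)\<^sup>2 + e) * sqrt ((s - q)\<^sup>2 + e))"
  have M: "?M s \<noteq> 0" for s
    using softmax_ge(2)[of e q s] assms by simp
  have pos: "(s - q)\<^sup>2 + e \<noteq> 0" for s
    using assms(2) by (metis add_nonneg_pos less_irrefl zero_le_power2)
  define C where "C = - \<kappa> * real (Suc m) * q ^ Suc m"
  have eq: "profile' m \<kappa> q e = (\<lambda>s. C * (?M' s * inverse (?M s ^ (m + 2))))"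
    by (auto simp: profile'_def C_def field_simps power_divide)
  let ?p = "\<lambda>s. C * (?M' s * (- (inverse (?M s ^ (m + 2)) * (real (m + 2) * ?M s ^ (m + 1) * ?M' s)
      * inverse (?M s ^ (m + 2)))) + ?M'' s * inverse (?M s ^ (m + 2)))"
  have "(profile' m \<kappa> q e has_real_derivative ?p s) (at s)" for s
  proof -
    have "((\<lambda>s. ?M s ^ (m + 2)) has_real_derivative real (m + 2) * ?M s ^ (m + 1) * ?M' s) (at s)"
      using DERIV_power[OF DERIV_softmax[OF assms(2), of q s], of "m + 2"] by (simp add: mult_ac)
    then have "((\<lambda>s. inverse (?M s ^ (m + 2))) has_real_derivative
        - (inverse (?M s ^ (m + 2)) * (real (m + 2) * ?M s ^ (m + 1) * ?M' s) * inverse (?M s ^ (m + 2)))) (at s)"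
      by (rule DERIV_inverse') (use M in simp)
    from DERIV_cmult[OF DERIV_mult'[OF DERIV_softmax'[OF assms(2)] this], of C] show ?thesis
      unfolding eq .
  qed
  moreover have "continuous_on UNIV ?p"
  proof -
    have "continuous_on UNIV ?M" "continuous_on UNIV ?M'"
      using DERIV_softmax[OF assms(2)] DERIV_softmax'[OF assms(2)]
      by (meson DERIV_isCont continuous_at_imp_continuous_on)+
    moreover have "2 * ((s - q)\<^sup>2 + e) * sqrt ((s - q)\<^sup>2 + e) \<noteq> 0" "?M s ^ (m + 2) \<noteq> 0" for s
      using M pos by (simp_all del: distrib_left_numeral)
    ultimately show ?thesis
      by (intro continuous_intros ballI)
  qed
  ultimately show ?thesis by (rule that)
qed

lemma DERIV_shifted_power:
  fixes c :: complex
  shows "((\<lambda>z. \<alpha> * (z - c) ^ Suc m) has_field_derivative of_nat (Suc m) * \<alpha> * (z - c) ^ m) (at z)"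
proof -
  have "((\<lambda>z. z - c) has_field_derivative 1) (at z)"
    by (auto intro!: derivative_eq_intros)
  from DERIV_cmult[OF DERIV_power_Suc[OF this, of m], of \<alpha>] show ?thesis
    by (simp add: algebra_simps)
qed

lemma C1_potential:
  assumes "q > 0" "e > 0"
  shows "C1_with_gradient (potential m \<kappa> q c \<alpha> e) (potential_grad m \<kappa> q c \<alpha> e)"
proof -
  obtain p where p: "\<And>s. (profile' m \<kappa> q e has_real_derivative p s) (at s)"
    using DERIV_profile'[OF assms] by metis
  then have cp: "continuous_on UNIV (profile' m \<kappa> q e)"
    by (meson DERIV_isCont continuous_at_imp_continuous_on)
  have "C1_with_gradient (\<lambda>z. Re (\<alpha> * (z - c) ^ Suc m)) (\<lambda>z. cnj (of_nat (Suc m) * \<alpha> * (z - c) ^ m))"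
    by (intro C1_Re_holomorphic DERIV_shifted_power continuous_intros)
  from C1_mult[OF this C1_compose[OF C1_norm_sq[of c] DERIV_profile[OF assms, of m \<kappa>] cp]]
  show ?thesis
    by (simp add: potential_def[abs_def] potential_grad_def[abs_def] algebra_simps)
qed

lemma green_potential:
  assumes "q > 0" "e > 0" "C1_with_gradient \<phi> \<Phi>"
  shows "(\<integral>z. \<Phi> z \<bullet> (- \<i> * potential_grad m \<kappa> q c \<alpha> e z) \<partial>lebesgue_on \<Omega>)
    = (\<integral>t. \<phi> (cis t) * ((- \<i> * potential_grad m \<kappa> q c \<alpha> e (cis t)) \<bullet> cis t) \<partial>lebesgue_on {0..2*pi})"
proof -
  obtain p where p: "\<And>s. (profile' m \<kappa> q e has_real_derivative p s) (at s)" "continuous_on UNIV p"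
    using DERIV_profile'[OF assms(1,2)] by metis
  show ?thesis
    unfolding potential_grad_def
  proof (rule green_stream_function[OF _ _ _ DERIV_profile[OF assms(1,2)] p assms(3)])
    fix z
    show "((\<lambda>z. \<alpha> * (z - c) ^ Suc m) has_field_derivative of_nat (Suc m) * \<alpha> * (z - c) ^ m) (at z)"
      by (rule DERIV_shifted_power)
    show "((\<lambda>z. of_nat (Suc m) * \<alpha> * (z - c) ^ m) has_field_derivative
        of_nat (Suc m) * \<alpha> * (of_nat m * (z - c) ^ (m - 1))) (at z)"
      by (auto intro!: derivative_eq_intros)
    show "continuous_on UNIV (\<lambda>z. of_nat (Suc m) * \<alpha> * (of_nat m * (z - c) ^ (m - 1)))"
      by (intro continuous_intros)
  qed
qed

lemma softmax_tendsto:
  "(\<lambda>k. softmax q (1 / real (Suc k)) s) \<longlonglongrightarrow> softmax q 0 s"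
  "(\<lambda>k. softmax' q (1 / real (Suc k)) s) \<longlonglongrightarrow> softmax' q 0 s"
proof -
  have e: "(\<lambda>k. 1 / real (Suc k)) \<longlonglongrightarrow> 0"
    using LIMSEQ_inverse_real_of_nat by (simp add: inverse_eq_divide)
  show "(\<lambda>k. softmax q (1 / real (Suc k)) s) \<longlonglongrightarrow> softmax q 0 s"
    unfolding softmax_def by (intro tendsto_intros e) auto
  show "(\<lambda>k. softmax' q (1 / real (Suc k)) s) \<longlonglongrightarrow> softmax' q 0 s"
  \<comment> \<open>At \<open>s = q\<close> the sequence is constant, since the quotient is 0 for
    every e, zero included.\<close>
  proof (cases "s = q")
    case False
    then show ?thesis
      unfolding softmax'_def by (intro tendsto_intros e) auto
  qed (simp add: softmax'_def)
qed

lemma potential_tendsto: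
  assumes "q > 0"
  shows "(\<lambda>k. potential m \<kappa> q c \<alpha> (1 / real (Suc k)) z) \<longlonglongrightarrow> potential m \<kappa> q c \<alpha> 0 z"
    "(\<lambda>k. potential_grad m \<kappa> q c \<alpha> (1 / real (Suc k)) z) \<longlonglongrightarrow> potential_grad m \<kappa> q c \<alpha> 0 z"
proof -
  have M: "softmax q 0 s \<noteq> 0" for s
    using softmax_ge(2)[of 0 q s] assms by simp
  show "(\<lambda>k. potential m \<kappa> q c \<alpha> (1 / real (Suc k)) z) \<longlonglongrightarrow> potential m \<kappa> q c \<alpha> 0 z"
    unfolding potential_def profile_def by (intro tendsto_intros softmax_tendsto M)
  show "(\<lambda>k. potential_grad m \<kappa> q c \<alpha> (1 / real (Suc k)) z) \<longlonglongrightarrow> potential_grad m \<kappa> q c \<alpha> 0 z"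
    unfolding potential_grad_def profile_def profile'_def by (intro tendsto_intros softmax_tendsto M)
qed

text \<open>One constant serves all smoothing parameters, as bounded convergence requires;
  \<open>L\<close> bounds the distance from c to points of the closed unit disk.\<close>

lemma potential_bound:
  assumes "q > 0"
  obtains B where "\<And>e z. e \<ge> 0 \<Longrightarrow> norm z \<le> 1 \<Longrightarrow> \<bar>potential m \<kappa> q c \<alpha> e z\<bar> \<le> B"
    "\<And>e z. e \<ge> 0 \<Longrightarrow> norm z \<le> 1 \<Longrightarrow> norm (potential_grad m \<kappa> q c \<alpha> e z) \<le> B"
proof -
  define L where "L = 1 + norm c"
  define P where "P = norm \<alpha> * L ^ Suc m"
  define P' where "P' = real (Suc m) * norm \<alpha> * L ^ m"
  define B where "B = max (P * (1 + \<bar>\<kappa>\<bar>)) ((1 + \<bar>\<kappa>\<bar>) * P' + 2 * P * (\<bar>\<kappa>\<bar> * real (Suc m) / q) * L)"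
  have L: "norm (z - c) \<le> L" if "norm z \<le> 1" for z
    using norm_triangle_ineq4[of z c] that by (simp add: L_def)
  have P: "\<bar>Re (\<alpha> * (z - c) ^ Suc m)\<bar> \<le> P" if "norm z \<le> 1" for z
  proof -
    have "\<bar>Re (\<alpha> * (z - c) ^ Suc m)\<bar> \<le> norm (\<alpha> * (z - c) ^ Suc m)"
      by (rule abs_Re_le_cmod)
    also have "\<dots> \<le> P"
      unfolding P_def norm_mult norm_power using L[OF that] by (intro mult_left_mono power_mono) auto
    finally show ?thesis .
  qed
  have P': "norm (cnj (of_nat (Suc m) * \<alpha> * (z - c) ^ m)) \<le> P'" if "norm z \<le> 1" for z
    unfolding P'_def complex_mod_cnj norm_mult norm_power norm_of_nat
    using L[OF that] by (intro mult_left_mono power_mono) auto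
  have nn: "0 \<le> P" "0 \<le> P'" "0 \<le> L"
    by (auto simp: P_def P'_def L_def)
  show ?thesis
  proof (rule that)
    fix e :: real and z :: complex assume e: "e \<ge> 0" and z: "norm z \<le> 1"
    let ?s = "(norm (z - c))\<^sup>2"
    note b = profile_bound[OF assms e, of m \<kappa> ?s] profile'_bound[OF assms e, of m \<kappa> ?s]
    have "\<bar>potential m \<kappa> q c \<alpha> e z\<bar> \<le> P * (1 + \<bar>\<kappa>\<bar>)"
      unfolding potential_def abs_mult using b P[OF z] nn by (intro mult_mono) auto
    then show "\<bar>potential m \<kappa> q c \<alpha> e z\<bar> \<le> B"
      by (simp add: B_def)
    have "norm (potential_grad m \<kappa> q c \<alpha> e z)
        \<le> \<bar>profile m \<kappa> q e ?s\<bar> * norm (cnj (of_nat (Suc m) * \<alpha> * (z - c) ^ m))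
          + 2 * \<bar>Re (\<alpha> * (z - c) ^ Suc m)\<bar> * \<bar>profile' m \<kappa> q e ?s\<bar> * norm (z - c)"
      unfolding potential_grad_def by (rule order.trans[OF norm_triangle_ineq]) (simp add: abs_mult del: times_complex.sel power_Suc)
    also have "\<dots> \<le> (1 + \<bar>\<kappa>\<bar>) * P' + 2 * P * (\<bar>\<kappa>\<bar> * real (Suc m) / q) * L"
      using b P[OF z] P'[OF z] L[OF z] nn assms by (intro add_mono mult_mono) auto
    also have "\<dots> \<le> B" by (simp add: B_def)
    finally show "norm (potential_grad m \<kappa> q c \<alpha> e z) \<le> B" .
  qed
qed

lemma potential_measurable:
  assumes "q > 0"
  shows "potential m \<kappa> q c \<alpha> 0 \<in> borel_measurable borel" "potential_grad m \<kappa> q c \<alpha> 0 \<in> borel_measurable borel"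
proof -
  have C1: "C1_with_gradient (potential m \<kappa> q c \<alpha> (1 / real (Suc k))) (potential_grad m \<kappa> q c \<alpha> (1 / real (Suc k)))" for k
    by (rule C1_potential[OF assms]) simp
  show "potential m \<kappa> q c \<alpha> 0 \<in> borel_measurable borel"
    by (rule borel_measurable_LIMSEQ_metric[OF borel_measurable_continuous_onI[OF continuous_on_C1(1)[OF C1]]])
      (rule potential_tendsto[OF assms])
  show "potential_grad m \<kappa> q c \<alpha> 0 \<in> borel_measurable borel"
    by (rule borel_measurable_LIMSEQ_metric[OF borel_measurable_continuous_onI[OF continuous_on_C1(2)[OF C1]]])
      (rule potential_tendsto[OF assms])
qed

lemma borel_measurable_lebesgue_onI:
  fixes f :: "'a::euclidean_space \<Rightarrow> 'b::euclidean_space"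
  assumes "f \<in> borel_measurable borel"
  shows "f \<in> borel_measurable (lebesgue_on S)"
  using assms by (simp add: measurable_completion measurable_restrict_space1)

text \<open>The smoothed potentials are C1 and converge pointwise and boundedly together with their
  gradients, in the disk and on the circle. They form the approximating sequence that
  \<open>has_trace\<close> asks for.\<close>

lemma potential_has_trace:
  assumes "q > 0"
  shows "has_trace (potential m \<kappa> q c \<alpha> 0) (\<lambda>t. potential m \<kappa> q c \<alpha> 0 (cis t))"
    and "AE x in lebesgue_on \<Omega>. grad (potential m \<kappa> q c \<alpha> 0) x = potential_grad m \<kappa> q c \<alpha> 0 x"
proof -
  let ?W = "potential m \<kappa> q c \<alpha>" and ?G = "potential_grad m \<kappa> q c \<alpha>"
  obtain B where B: "\<And>e z. e \<ge> 0 \<Longrightarrow> norm z \<le> 1 \<Longrightarrow> \<bar>?W e z\<bar> \<le> B"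
    "\<And>e z. e \<ge> 0 \<Longrightarrow> norm z \<le> 1 \<Longrightarrow> norm (?G e z) \<le> B"
    using potential_bound[OF assms] by metis
  have C1: "C1_with_gradient (?W (1 / real (Suc k))) (?G (1 / real (Suc k)))" for k
    by (rule C1_potential[OF assms]) simp
  note m = borel_measurable_lebesgue_onI[OF potential_measurable(1)[OF assms]]
    borel_measurable_lebesgue_onI[OF potential_measurable(2)[OF assms]]
  have mc: "(\<lambda>t. ?W 0 (cis t)) \<in> borel_measurable (lebesgue_on {0..2*pi})"
    by (intro borel_measurable_lebesgue_onI measurable_compose[OF _ potential_measurable(1)[OF assms]]
        borel_measurable_continuous_onI continuous_intros)
  have W: "?W 0 \<in> L2 (lebesgue_on \<Omega>)" and G: "?G 0 \<in> L2 (lebesgue_on \<Omega>)"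
    using B by (auto intro!: L2_bounded[where B=B] lebesgue_disk.finite_measure_axioms m)
  have tW: "tendsto_L2 (lebesgue_on \<Omega>) (\<lambda>k. ?W (1 / real (Suc k))) (?W 0)"
  proof (rule tendsto_L2_bounded_convergence[OF lebesgue_disk.finite_measure_axioms L2D(1)[OF C1_L2_disk(1)[OF C1]] m(1)])
    show "(\<lambda>k. ?W (1 / real (Suc k)) z) \<longlonglongrightarrow> ?W 0 z" for z
      by (rule potential_tendsto[OF assms])
    show "norm (?W (1 / real (Suc k)) z) \<le> B" if "z \<in> space (lebesgue_on \<Omega>)" for k z
      using that B(1)[of "1 / real (Suc k)" z] by simp
  qed
  have tG: "tendsto_L2 (lebesgue_on \<Omega>) (\<lambda>k. ?G (1 / real (Suc k))) (?G 0)"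
  proof (rule tendsto_L2_bounded_convergence[OF lebesgue_disk.finite_measure_axioms L2D(1)[OF C1_L2_disk(2)[OF C1]] m(2)])
    show "(\<lambda>k. ?G (1 / real (Suc k)) z) \<longlonglongrightarrow> ?G 0 z" for z
      by (rule potential_tendsto[OF assms])
    show "norm (?G (1 / real (Suc k)) z) \<le> B" if "z \<in> space (lebesgue_on \<Omega>)" for k z
      using that B(2)[of "1 / real (Suc k)" z] by simp
  qed
  have tc: "tendsto_L2 (lebesgue_on {0..2*pi}) (\<lambda>k t. ?W (1 / real (Suc k)) (cis t)) (\<lambda>t. ?W 0 (cis t))"
  proof (rule tendsto_L2_bounded_convergence[OF finite_measure_circle
        L2D(1)[OF continuous_L2_circle[OF continuous_on_C1(1)[OF C1]]] mc])
    show "(\<lambda>k. ?W (1 / real (Suc k)) (cis t)) \<longlonglongrightarrow> ?W 0 (cis t)" for t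
      by (rule potential_tendsto[OF assms])
    show "norm (?W (1 / real (Suc k)) (cis t)) \<le> B" for k t
      using B(1)[of "1 / real (Suc k)" "cis t"] by simp
  qed
  have wg: "has_weak_gradient (?W 0) (?G 0)"
    by (rule has_weak_gradient_limit[OF C1 W tW G tG])
  show ae: "AE x in lebesgue_on \<Omega>. grad (?W 0) x = ?G 0 x"
    by (rule grad_eqI(2)[OF W G wg])
  have H1: "?W 0 \<in> H1"
    by (rule grad_eqI(1)[OF W G wg])
  have tg: "tendsto_L2 (lebesgue_on \<Omega>) (\<lambda>k. ?G (1 / real (Suc k))) (grad (?W 0))"
  proof (rule tendsto_L2_AE_cong[OF L2D(1)[OF C1_L2_disk(2)[OF C1]] m(2) L2D(1)[OF grad_H1(1)[OF H1]] _ tG])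
    show "AE x in lebesgue_on \<Omega>. ?G 0 x = grad (?W 0) x"
      using ae by eventually_elim simp
  qed
  have per: "cis (t + 2 * pi) = cis t" for t
    by (simp add: complex_eq_iff)
  have "(\<lambda>t. ?W 0 (cis t)) \<in> L2_circle"
    unfolding L2_circle_def using B
    by (auto simp: per intro!: L2_bounded[where B=B] finite_measure_circle mc)
  then show "has_trace (?W 0) (\<lambda>t. ?W 0 (cis t))"
    unfolding has_trace_def
    by (intro conjI H1 exI[of _ "\<lambda>k. ?W (1 / real (Suc k))"] exI[of _ "\<lambda>k. ?G (1 / real (Suc k))"] allI C1 tW tg tc)
qed

text \<open>Two limits, each in one factor of a pairing: the smoothing tends to 0 against a fixed C1
  function, then C1 functions tend to \<open>v\<close>. The potential acts here as the stream
  function of the field.\<close>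

lemma green_potential_trace:
  assumes q: "q > 0" and v: "has_trace v g"
  shows "(\<integral>z. grad v z \<bullet> (- \<i> * potential_grad m \<kappa> q c \<alpha> 0 z) \<partial>lebesgue_on \<Omega>)
    = (\<integral>t. g t * ((- \<i> * potential_grad m \<kappa> q c \<alpha> 0 (cis t)) \<bullet> cis t) \<partial>lebesgue_on {0..2*pi})"
proof -
  let ?G = "potential_grad m \<kappa> q c \<alpha>"
  let ?Y = "\<lambda>e z. - \<i> * ?G e z"
  let ?N = "\<lambda>e t. (- \<i> * ?G e (cis t)) \<bullet> cis t"
  obtain B where B: "\<And>e z. e \<ge> 0 \<Longrightarrow> norm z \<le> 1 \<Longrightarrow> norm (?G e z) \<le> B"
    using potential_bound[OF q] by metis
  have C1: "C1_with_gradient (potential m \<kappa> q c \<alpha> (1 / real (Suc k))) (?G (1 / real (Suc k)))" for k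
    by (rule C1_potential[OF q]) simp
  have BY: "norm (?Y e z) \<le> B" if "e \<ge> 0" "norm z \<le> 1" for e z
    using B[OF that] by (simp add: norm_mult)
  have BN: "norm (?N e t) \<le> B" if "e \<ge> 0" for e t
    using Cauchy_Schwarz_ineq2[of "?Y e (cis t)" "cis t"] BY[OF that, of "cis t"] by simp
  have mY: "?Y 0 \<in> borel_measurable borel"
    using potential_measurable(2)[OF q] by (intro borel_measurable_times) auto
  have mN: "?N 0 \<in> borel_measurable (lebesgue_on {0..2*pi})"
    by (intro borel_measurable_lebesgue_onI borel_measurable_inner measurable_compose[OF _ mY]
        borel_measurable_continuous_onI continuous_intros)
  have cY: "continuous_on UNIV (?Y (1 / real (Suc k)))" for k
    by (intro continuous_intros continuous_on_C1(2)[OF C1])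
  have cN: "continuous_on UNIV (?N (1 / real (Suc k)))" for k
    by (intro continuous_intros continuous_on_compose2[OF continuous_on_C1(2)[OF C1, of UNIV]]) auto
  have Y: "?Y (1 / real (Suc k)) \<in> L2 (lebesgue_on \<Omega>)" for k
    by (rule continuous_L2_disk[OF cY])
  have Y0: "?Y 0 \<in> L2 (lebesgue_on \<Omega>)"
    by (rule L2_bounded[OF lebesgue_disk.finite_measure_axioms borel_measurable_lebesgue_onI[OF mY]])
      (rule BY, simp, simp)
  have N: "?N (1 / real (Suc k)) \<in> L2 (lebesgue_on {0..2*pi})" for k
    by (rule L2_bounded[OF finite_measure_circle continuous_on_borel_measurable_lebesgue_on[OF cN]])
      (rule BN, simp)
  have N0: "?N 0 \<in> L2 (lebesgue_on {0..2*pi})"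
    by (rule L2_bounded[OF finite_measure_circle mN]) (rule BN, simp)
  have tY: "tendsto_L2 (lebesgue_on \<Omega>) (\<lambda>k. ?Y (1 / real (Suc k))) (?Y 0)"
  proof (rule tendsto_L2_bounded_convergence[OF lebesgue_disk.finite_measure_axioms L2D(1)[OF Y] L2D(1)[OF Y0]])
    show "(\<lambda>k. ?Y (1 / real (Suc k)) z) \<longlonglongrightarrow> ?Y 0 z" for z
      by (intro tendsto_intros potential_tendsto[OF q])
    show "norm (?Y (1 / real (Suc k)) z) \<le> B" if "z \<in> space (lebesgue_on \<Omega>)" for k z
      using that by (intro BY) auto
  qed
  have tN: "tendsto_L2 (lebesgue_on {0..2*pi}) (\<lambda>k. ?N (1 / real (Suc k))) (?N 0)"
  proof (rule tendsto_L2_bounded_convergence[OF finite_measure_circle L2D(1)[OF N] L2D(1)[OF N0]])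
    show "(\<lambda>k. ?N (1 / real (Suc k)) t) \<longlonglongrightarrow> ?N 0 t" for t
      by (intro tendsto_intros potential_tendsto[OF q])
    show "norm (?N (1 / real (Suc k)) t) \<le> B" for k t
      by (intro BN) auto
  qed
  have smooth: "(\<integral>z. \<Phi> z \<bullet> ?Y 0 z \<partial>lebesgue_on \<Omega>) = (\<integral>t. \<phi> (cis t) * ?N 0 t \<partial>lebesgue_on {0..2*pi})"
    if \<phi>: "C1_with_gradient \<phi> \<Phi>" for \<phi> \<Phi>
  proof -
    have 1: "(\<lambda>k. \<integral>z. \<Phi> z \<bullet> ?Y (1 / real (Suc k)) z \<partial>lebesgue_on \<Omega>) \<longlonglongrightarrow> (\<integral>z. \<Phi> z \<bullet> ?Y 0 z \<partial>lebesgue_on \<Omega>)"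
      by (rule tendsto_L2_bilinear[OF bounded_bilinear.flip[OF bounded_bilinear_inner] Y Y0 C1_L2_disk(2)[OF \<phi>] tY])
    have 2: "(\<lambda>k. \<integral>t. \<phi> (cis t) * ?N (1 / real (Suc k)) t \<partial>lebesgue_on {0..2*pi})
        \<longlonglongrightarrow> (\<integral>t. \<phi> (cis t) * ?N 0 t \<partial>lebesgue_on {0..2*pi})"
      by (rule tendsto_L2_bilinear[OF bounded_bilinear.flip[OF bounded_bilinear_mult] N N0
            continuous_L2_circle[OF continuous_on_C1(1)[OF \<phi>]] tN])
    have eq: "(\<integral>z. \<Phi> z \<bullet> ?Y (1 / real (Suc k)) z \<partial>lebesgue_on \<Omega>)
        = (\<integral>t. \<phi> (cis t) * ?N (1 / real (Suc k)) t \<partial>lebesgue_on {0..2*pi})" for k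
      by (rule green_potential[OF q _ \<phi>]) simp
    show ?thesis
      by (rule LIMSEQ_unique[OF 1[unfolded eq] 2])
  qed
  have H: "v \<in> H1" and g: "g \<in> L2 (lebesgue_on {0..2*pi})"
    using v by (auto simp: has_trace_def L2_circle_def)
  obtain \<phi> \<Phi> where \<phi>: "\<And>n. C1_with_gradient (\<phi> n) (\<Phi> n)"
    "tendsto_L2 (lebesgue_on \<Omega>) \<Phi> (grad v)" "tendsto_L2 (lebesgue_on {0..2*pi}) (\<lambda>n t. \<phi> n (cis t)) g"
    using v unfolding has_trace_def by blast
  have 1: "(\<lambda>n. \<integral>z. \<Phi> n z \<bullet> ?Y 0 z \<partial>lebesgue_on \<Omega>) \<longlonglongrightarrow> (\<integral>z. grad v z \<bullet> ?Y 0 z \<partial>lebesgue_on \<Omega>)"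
    by (rule tendsto_L2_bilinear[OF bounded_bilinear_inner C1_L2_disk(2)[OF \<phi>(1)] grad_H1(1)[OF H] Y0 \<phi>(2)])
  have 2: "(\<lambda>n. \<integral>t. \<phi> n (cis t) * ?N 0 t \<partial>lebesgue_on {0..2*pi}) \<longlonglongrightarrow> (\<integral>t. g t * ?N 0 t \<partial>lebesgue_on {0..2*pi})"
    by (rule tendsto_L2_bilinear[OF bounded_bilinear_mult continuous_L2_circle[OF continuous_on_C1(1)[OF \<phi>(1)]] g N0 \<phi>(3)])
  show ?thesis
    by (rule LIMSEQ_unique[OF 1[unfolded smooth[OF \<phi>(1)]] 2])
qed

section \<open>Boundary values and fluxes\<close>

lemma potential_grad_inside:
  assumes "(norm (z - c))\<^sup>2 < q"
  shows "potential_grad m \<kappa> q c \<alpha> 0 z = of_real (1 + \<kappa>) * cnj (of_nat (Suc m) * \<alpha> * (z - c) ^ m)"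
proof -
  have "q > 0" using assms zero_le_power2[of "norm (z - c)"] by linarith
  then show ?thesis
    using assms
    by (simp add: potential_grad_def profile_def profile'_def softmax_zero scaleR_conv_of_real)
qed

text \<open>With w = z - c and n = \<open>Suc m\<close>, the second term of the potential is
  \<open>\<kappa> * q ^ n * Re (cnj \<alpha> / w ^ n)\<close> outside the disk. Conjugating the
  derivative gives the gradient \<open>- n * \<kappa> * q ^ n * \<alpha> / cnj w ^ (n + 1)\<close>;
  the statement keeps the real factor \<open>(q / (norm w)\<^sup>2) ^ n\<close> apart.\<close>

lemma potential_grad_outside:
  assumes "0 < q" "q < (norm (z - c))\<^sup>2"
  shows "potential_grad m \<kappa> q c \<alpha> 0 z = of_nat (Suc m) *
    (cnj (\<alpha> * (z - c) ^ m) - of_real (\<kappa> * (q / (norm (z - c))\<^sup>2) ^ Suc m) * (\<alpha> * (z - c) ^ Suc m) / cnj (z - c))"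
proof -
  define w s \<rho> where "w = z - c" and "s = (norm w)\<^sup>2" and "\<rho> = \<kappa> * (q / s) ^ Suc m"
  define a where "a = \<alpha> * w ^ Suc m"
  have s: "s > 0" "q < s"
    using assms(2) less_trans[OF assms] by (simp_all only: s_def w_def)
  then have w: "w \<noteq> 0" by (auto simp: s_def)
  have sw: "complex_of_real s = w * cnj w"
    unfolding s_def by (rule complex_norm_square)
  have "potential_grad m \<kappa> q c \<alpha> 0 z = of_real (1 + \<rho>) * (of_nat (Suc m) * cnj (\<alpha> * w ^ m))
      - of_nat (Suc m) * of_real \<rho> * (of_real (2 * Re a) * w / of_real s)"
    using s unfolding potential_grad_def w_def[symmetric] s_def[symmetric] a_def[symmetric]
    by (simp add: profile_def profile'_def softmax_zero scaleR_conv_of_real \<rho>_def field_simps del: power_Suc)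
  \<comment> \<open>From 2 Re a = a + cnj a; the conjugate half then cancels the \<rho> part of the
    first term.\<close>
  also have "of_real (2 * Re a) * w / of_real s = a / cnj w + cnj (\<alpha> * w ^ m)"
  proof -
    have "of_real (2 * Re a) = a + cnj a"
      by (simp add: complex_add_cnj)
    moreover have "cnj a = cnj (\<alpha> * w ^ m) * cnj w"
      by (simp add: a_def)
    ultimately show ?thesis
      using w unfolding sw by (simp add: field_simps)
  qed
  finally show ?thesis
    unfolding w_def[symmetric] s_def[symmetric] \<rho>_def[symmetric] a_def[symmetric]
    by (simp add: algebra_simps add_divide_distrib)
qed

text \<open>Replacing \<alpha> by \<open>- \<i> * \<alpha>\<close> and rotating by
  \<open>- \<i>\<close> restores the term \<open>cnj (\<alpha> * (z - c) ^ m)\<close> and reverses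
  the sign of the reflected term, which \<open>- \<kappa>\<close> undoes. Inside, the claim is
  \<open>\<sigma>\<^sub>2 * (1 + \<kappa>) = \<sigma>\<^sub>1 * (1 - \<kappa>)\<close>. On the
  sphere the fields may jump.\<close>

lemma conductivity_potential_grad:
  assumes "r > 0" "\<kappa> * (\<sigma>\<^sub>1 + \<sigma>\<^sub>2) = \<sigma>\<^sub>1 - \<sigma>\<^sub>2" "z \<notin> sphere c r"
  shows "conductivity \<sigma>\<^sub>1 \<sigma>\<^sub>2 (ball c r) z *\<^sub>R potential_grad m \<kappa> (r\<^sup>2) c \<alpha> 0 z
    = \<sigma>\<^sub>1 *\<^sub>R (- \<i> * potential_grad m (- \<kappa>) (r\<^sup>2) c (- \<i> * \<alpha>) 0 z)"
proof (cases "z \<in> ball c r")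
  case True
  then have "(norm (z - c))\<^sup>2 < r\<^sup>2"
    by (intro power_strict_mono) (auto simp: dist_norm norm_minus_commute)
  note i = potential_grad_inside[OF this]
  have k: "\<sigma>\<^sub>2 * (1 + \<kappa>) = \<sigma>\<^sub>1 * (1 - \<kappa>)"
    using assms(2) by (simp add: algebra_simps)
  have "conductivity \<sigma>\<^sub>1 \<sigma>\<^sub>2 (ball c r) z *\<^sub>R potential_grad m \<kappa> (r\<^sup>2) c \<alpha> 0 z
      = of_real (\<sigma>\<^sub>2 * (1 + \<kappa>)) * cnj (of_nat (Suc m) * \<alpha> * (z - c) ^ m)"
    unfolding i using True by (simp add: conductivity_def scaleR_conv_of_real)
  also have "\<dots> = \<sigma>\<^sub>1 *\<^sub>R (- \<i> * potential_grad m (- \<kappa>) (r\<^sup>2) c (- \<i> * \<alpha>) 0 z)"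
    unfolding i k by (simp add: scaleR_conv_of_real algebra_simps)
  finally show ?thesis .
next
  case False
  then have "r < norm (z - c)"
    using assms(3) by (auto simp: dist_norm norm_minus_commute)
  then have "r\<^sup>2 < (norm (z - c))\<^sup>2"
    using assms(1) by (intro power_strict_mono) auto
  note o = potential_grad_outside[OF _ this]
  show ?thesis
    using False assms(1) by (simp add: conductivity_def o scaleR_conv_of_real algebra_simps del: power_Suc)
qed

text \<open>The sphere is a null set, so the weighted gradient may be replaced by the rotated one
  and Green's formula applies on the whole unit disk. For \<open>g = 0\<close> the result says that
  the potential is a weak solution; for other g it reads off the flux.\<close>

lemma energy_potential:
  assumes r: "r > 0" and \<kappa>: "\<kappa> * (\<sigma>\<^sub>1 + \<sigma>\<^sub>2) = \<sigma>\<^sub>1 - \<sigma>\<^sub>2" and v: "has_trace v g"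
  shows "energy \<sigma>\<^sub>1 \<sigma>\<^sub>2 (ball c r) (potential m \<kappa> (r\<^sup>2) c \<alpha> 0) v
    = \<sigma>\<^sub>1 * (\<integral>t. g t * ((- \<i> * potential_grad m (- \<kappa>) (r\<^sup>2) c (- \<i> * \<alpha>) 0 (cis t)) \<bullet> cis t) \<partial>lebesgue_on {0..2*pi})"
proof -
  let ?W = "potential m \<kappa> (r\<^sup>2) c \<alpha> 0"
  let ?Y = "\<lambda>z. - \<i> * potential_grad m (- \<kappa>) (r\<^sup>2) c (- \<i> * \<alpha>) 0 z"
  have q: "r\<^sup>2 > 0" using r by simp
  have W: "?W \<in> H1" and H: "v \<in> H1"
    using potential_has_trace(1)[OF q] v by (auto simp: has_trace_def)
  have "negligible (sphere c r)"
    by (rule negligible_sphere)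
  then have "AE z in lebesgue. z \<notin> sphere c r"
    using negligible_iff_null_sets by (blast intro: AE_not_in)
  then have sph: "AE z in lebesgue_on \<Omega>. z \<notin> sphere c r"
    by (subst AE_restrict_space_iff) auto
  have mY: "?Y \<in> borel_measurable (lebesgue_on \<Omega>)"
    using potential_measurable(2)[OF q] by (intro borel_measurable_lebesgue_onI borel_measurable_times) auto
  have "energy \<sigma>\<^sub>1 \<sigma>\<^sub>2 (ball c r) ?W v = (\<integral>z. \<sigma>\<^sub>1 * (grad v z \<bullet> ?Y z) \<partial>lebesgue_on \<Omega>)"
    unfolding energy_def
  proof (rule integral_cong_AE)
    show "(\<lambda>z. conductivity \<sigma>\<^sub>1 \<sigma>\<^sub>2 (ball c r) z * (grad ?W z \<bullet> grad v z)) \<in> borel_measurable (lebesgue_on \<Omega>)"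
      using energy_integrable[OF _ W H] by (intro borel_measurable_integrable) auto
    show "(\<lambda>z. \<sigma>\<^sub>1 * (grad v z \<bullet> ?Y z)) \<in> borel_measurable (lebesgue_on \<Omega>)"
      by (intro borel_measurable_times borel_measurable_const borel_measurable_inner mY L2D(1) grad_H1 H)
    show "AE z in lebesgue_on \<Omega>. conductivity \<sigma>\<^sub>1 \<sigma>\<^sub>2 (ball c r) z * (grad ?W z \<bullet> grad v z) = \<sigma>\<^sub>1 * (grad v z \<bullet> ?Y z)"
      using sph potential_has_trace(2)[OF q, of m \<kappa> c \<alpha>]
    proof eventually_elim
      case (elim z)
      have "conductivity \<sigma>\<^sub>1 \<sigma>\<^sub>2 (ball c r) z * (grad ?W z \<bullet> grad v z)
          = (conductivity \<sigma>\<^sub>1 \<sigma>\<^sub>2 (ball c r) z *\<^sub>R potential_grad m \<kappa> (r\<^sup>2) c \<alpha> 0 z) \<bullet> grad v z"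
        unfolding elim(2) by simp
      also have "\<dots> = (\<sigma>\<^sub>1 *\<^sub>R ?Y z) \<bullet> grad v z"
        unfolding conductivity_potential_grad[OF r \<kappa> elim(1)] ..
      also have "\<dots> = \<sigma>\<^sub>1 * (grad v z \<bullet> ?Y z)"
        unfolding inner_scaleR_left inner_commute[of "?Y z"] ..
      finally show ?case .
    qed
  qed
  also have "\<dots> = \<sigma>\<^sub>1 * (\<integral>z. grad v z \<bullet> ?Y z \<partial>lebesgue_on \<Omega>)"
    by (rule integral_mult_right_zero)
  also have "(\<integral>z. grad v z \<bullet> ?Y z \<partial>lebesgue_on \<Omega>) = (\<integral>t. g t * (?Y (cis t) \<bullet> cis t) \<partial>lebesgue_on {0..2*pi})"
    by (rule green_potential_trace[OF q v])
  finally show ?thesis .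
qed

text \<open>On the unit circle \<open>cnj z = 1 / z\<close>, so that the boundary values of the potential and of its normal
  derivative become real parts of functions holomorphic in a neighbourhood of the closed disk.\<close>

definition boundary_value :: "nat \<Rightarrow> real \<Rightarrow> real \<Rightarrow> complex \<Rightarrow> complex \<Rightarrow> complex \<Rightarrow> complex" where
  "boundary_value m \<kappa> q c \<alpha> z =
     \<alpha> * (z - c) ^ Suc m + of_real (\<kappa> * q ^ Suc m) * \<alpha> * z ^ Suc m / (1 - cnj c * z) ^ Suc m"

definition boundary_flux :: "nat \<Rightarrow> real \<Rightarrow> real \<Rightarrow> complex \<Rightarrow> complex \<Rightarrow> complex \<Rightarrow> complex" where
  "boundary_flux m \<kappa> q c \<alpha> z =
     of_nat (Suc m) * (\<alpha> * z * (z - c) ^ m - of_real (\<kappa> * q ^ Suc m) * \<alpha> * z ^ Suc m / (1 - cnj c * z) ^ (m + 2))"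

lemma circle_factor:
  assumes "norm z = 1"
  shows "cnj (z - c) = (1 - cnj c * z) / z" and "of_real ((norm (z - c))\<^sup>2) = (z - c) * ((1 - cnj c * z) / z)"
proof -
  have z: "z \<noteq> 0" "z * cnj z = 1"
    using assms by (auto simp: complex_norm_square[symmetric])
  then have "cnj z = 1 / z"
    by (simp add: field_simps)
  then show *: "cnj (z - c) = (1 - cnj c * z) / z"
    using z(1) by (simp add: diff_divide_distrib)
  show "of_real ((norm (z - c))\<^sup>2) = (z - c) * ((1 - cnj c * z) / z)"
    unfolding complex_norm_square * ..
qed

lemma circle_outside:
  assumes "0 < r" "norm c + r < 1" "norm z = 1"
  shows "r\<^sup>2 < (norm (z - c))\<^sup>2"
proof -
  have "r < norm (z - c)"
    using norm_triangle_ineq2[of z c] assms by simp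
  then show ?thesis
    using assms(1) by (intro power_strict_mono) auto
qed

lemma potential_circle:
  assumes "0 < r" "norm c + r < 1" "norm z = 1"
  shows "potential m \<kappa> (r\<^sup>2) c \<alpha> 0 z = Re (boundary_value m \<kappa> (r\<^sup>2) c \<alpha> z)"
proof -
  define w b s where "w = z - c" and "b = 1 - cnj c * z" and "s = (norm w)\<^sup>2"
  note out = circle_outside[OF assms, folded w_def, folded s_def]
  have z: "z \<noteq> 0" using assms(3) by auto
  have w: "w \<noteq> 0" using out zero_le_power2[of r] by (auto simp: s_def)
  have cw: "cnj w = b / z" and sw: "of_real s = w * (b / z)"
    using circle_factor[OF assms(3), of c] by (simp_all add: w_def b_def s_def)
  have b: "b \<noteq> 0" using cw w by auto
  define \<kappa>' where "\<kappa>' = \<kappa> * (r\<^sup>2) ^ Suc m"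
  have "potential m \<kappa> (r\<^sup>2) c \<alpha> 0 z = Re (\<alpha> * w ^ Suc m) * (1 + \<kappa>' / s ^ Suc m)"
    using out by (simp add: potential_def profile_def softmax_zero w_def[symmetric] s_def[symmetric] \<kappa>'_def power_divide del: power_Suc)
  also have "\<dots> = Re (of_real (1 + \<kappa>' / s ^ Suc m) * (\<alpha> * w ^ Suc m))"
    by (simp del: power_Suc)
  also have "of_real (1 + \<kappa>' / s ^ Suc m) * (\<alpha> * w ^ Suc m) = \<alpha> * w ^ Suc m + of_real \<kappa>' * (\<alpha> * w ^ Suc m / of_real s ^ Suc m)"
    by (simp add: algebra_simps del: power_Suc)
  \<comment> \<open>On the unit circle the squared modulus of w is w b / z, so the powers of w
    cancel. The only possible pole left is 1 / cnj c, outside the closed unit disk.\<close>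
  also have "\<alpha> * w ^ Suc m / of_real s ^ Suc m = \<alpha> * z ^ Suc m / b ^ Suc m"
    unfolding sw using w z b by (simp add: power_mult_distrib power_divide del: power_Suc)
  finally show ?thesis
    by (simp add: boundary_value_def w_def b_def \<kappa>'_def mult.assoc del: power_Suc times_complex.sel)
qed

text \<open>The unit circle lies outside the disk, where the rotated gradient of the stream function
  is the gradient of the potential itself; its scalar product with z is the outward normal
  derivative.\<close>

lemma flux_circle:
  assumes "0 < r" "norm c + r < 1" "norm z = 1"
  shows "(- \<i> * potential_grad m (- \<kappa>) (r\<^sup>2) c (- \<i> * \<alpha>) 0 z) \<bullet> z = Re (boundary_flux m \<kappa> (r\<^sup>2) c \<alpha> z)"
proof -
  define w b s where "w = z - c" and "b = 1 - cnj c * z" and "s = (norm w)\<^sup>2"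
  note out = circle_outside[OF assms, folded w_def, folded s_def]
  have z: "z \<noteq> 0" and zz: "z * cnj z = 1"
    using assms(3) by (auto simp: complex_norm_square[symmetric])
  have w: "w \<noteq> 0" using out zero_le_power2[of r] by (auto simp: s_def)
  have cw: "cnj w = b / z" and sw: "of_real s = w * (b / z)"
    using circle_factor[OF assms(3), of c] by (simp_all add: w_def b_def s_def)
  have b: "b \<noteq> 0" using cw w by auto
  define \<kappa>' where "\<kappa>' = \<kappa> * (r\<^sup>2) ^ Suc m"
  have r2: "r\<^sup>2 > 0" using assms(1) by simp
  define P where "P = potential_grad m (- \<kappa>) (r\<^sup>2) c (- \<i> * \<alpha>) 0 z"
  have "P = of_nat (Suc m) * (cnj (- \<i> * \<alpha> * w ^ m)
      - of_real (- \<kappa> * (r\<^sup>2 / s) ^ Suc m) * (- \<i> * \<alpha> * w ^ Suc m) / cnj w)"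
    unfolding P_def w_def s_def by (rule potential_grad_outside[OF r2 circle_outside[OF assms]])
  moreover have "cnj (- \<i> * \<alpha> * w ^ m) = \<i> * cnj (\<alpha> * w ^ m)"
    by simp
  moreover have "of_real (- \<kappa> * (r\<^sup>2 / s) ^ Suc m) * (- \<i> * \<alpha> * w ^ Suc m) / cnj w
      = \<i> * (of_real (\<kappa>' / s ^ Suc m) * (\<alpha> * w ^ Suc m) / cnj w)"
    by (simp add: \<kappa>'_def power_divide mult_ac del: power_Suc)
  ultimately have "P = \<i> * (of_nat (Suc m) * (cnj (\<alpha> * w ^ m)
      - of_real (\<kappa>' / s ^ Suc m) * (\<alpha> * w ^ Suc m) / cnj w))"
    by (simp only: right_diff_distrib mult.left_commute)
  then have "- \<i> * P = of_nat (Suc m) * (cnj (\<alpha> * w ^ m)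
      - of_real (\<kappa>' / s ^ Suc m) * (\<alpha> * w ^ Suc m) / cnj w)"
    by (simp only: mult.assoc[symmetric]) simp
  also have "of_real (\<kappa>' / s ^ Suc m) * (\<alpha> * w ^ Suc m) / cnj w = of_real \<kappa>' * (\<alpha> * z ^ (m + 2) / b ^ (m + 2))"
    using w z b by (simp add: sw cw power_mult_distrib power_divide field_simps)
  finally have eq: "- \<i> * P
      = of_nat (Suc m) * (cnj (\<alpha> * w ^ m) - of_real \<kappa>' * (\<alpha> * z ^ (m + 2) / b ^ (m + 2)))" .
  have "(- \<i> * P) \<bullet> z
      = real (Suc m) * (Re (\<alpha> * w ^ m * z) - \<kappa>' * Re (cnj z * (\<alpha> * z ^ (m + 2) / b ^ (m + 2))))"
  proof -
    have "(of_nat n * (cnj X - of_real k * Y)) \<bullet> z = real n * (Re (X * z) - k * Re (cnj z * Y))"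
      for n k and X Y z :: complex
      by (simp add: inner_complex_def algebra_simps)
    then show ?thesis
      unfolding eq P_def[symmetric] .
  qed
  \<comment> \<open>The normal contributes \<open>cnj z\<close>, which is 1 / z on the circle and
    lowers the exponent of z but not that of b.\<close>
  also have "cnj z * (\<alpha> * z ^ (m + 2) / b ^ (m + 2)) = (z * cnj z) * (\<alpha> * z ^ Suc m / b ^ (m + 2))"
    by (simp add: algebra_simps)
  also have "\<dots> = \<alpha> * z ^ Suc m / b ^ (m + 2)"
    unfolding zz by simp
  finally have "(- \<i> * P) \<bullet> z = real (Suc m) * (Re (\<alpha> * w ^ m * z) - \<kappa>' * Re (\<alpha> * z ^ Suc m / b ^ (m + 2)))" .
  moreover have "boundary_flux m \<kappa> (r\<^sup>2) c \<alpha> z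
      = of_nat (Suc m) * (\<alpha> * w ^ m * z - of_real \<kappa>' * (\<alpha> * z ^ Suc m / b ^ (m + 2)))"
    by (simp add: boundary_flux_def w_def b_def \<kappa>'_def mult_ac del: power_Suc)
  moreover have "Re (of_nat n * (X - of_real k * Y)) = real n * (Re X - k * Re Y)" for n k and X Y :: complex
    by simp
  ultimately show ?thesis
    unfolding P_def by (simp only:)
qed

text \<open>On the circle \<open>cos t\<close> is the mean of \<open>cis t\<close> and its inverse.
  The first pairs with H to zero by Cauchy's theorem, the second extracts the derivative at 0 by
  Cauchy's formula.\<close>

lemma cos_pairing:
  assumes H: "H holomorphic_on ball 0 \<rho>" and \<rho>: "\<rho> > 1" and d: "(H has_field_derivative d) (at 0)"
  shows "(\<integral>t. cos t * Re (H (cis t)) \<partial>lebesgue_on {0..2*pi}) = pi * Re d"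
proof -
  have hc: "H holomorphic_on cball 0 1" "H holomorphic_on ball 0 1"
    using \<rho> by (auto intro: holomorphic_on_subset[OF H])
  have "(H has_contour_integral 0) (circlepath 0 1)"
    by (rule Cauchy_theorem_disc_simple[OF H]) (use \<rho> in auto)
  then have 1: "((\<lambda>t. H (cis t) * \<i> * cis t) has_integral 0) {0..2*pi}"
    unfolding circlepath_def by (subst (asm) has_contour_integral_part_circlepath_iff) auto
  have "((\<lambda>u. H u / (u - 0) ^ Suc 1) has_contour_integral (2 * pi * \<i> / fact 1 * (deriv ^^ 1) H 0)) (circlepath 0 1)"
    by (rule Cauchy_has_contour_integral_higher_derivative_circlepath)
      (use hc in \<open>auto intro: holomorphic_on_imp_continuous_on\<close>)
  then have 2: "((\<lambda>t. H (cis t) / (cis t)\<^sup>2 * \<i> * cis t) has_integral (2 * pi * \<i> * d)) {0..2*pi}"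
    using DERIV_imp_deriv[OF d] unfolding circlepath_def
    by (subst (asm) has_contour_integral_part_circlepath_iff) (auto simp: numeral_2_eq_2)
  \<comment> \<open>Along the circle dz is \<open>\<i> * cis t\<close> dt; the factor
    \<open>- \<i> / 2\<close> cancels this \<i> and takes the mean.\<close>
  have eq: "- \<i> / 2 * (H (cis t) * \<i> * cis t + H (cis t) / (cis t)\<^sup>2 * \<i> * cis t) = of_real (cos t) * H (cis t)" for t
  proof -
    have "- \<i> / 2 * (h * \<i> * e + h / e\<^sup>2 * \<i> * e) = (e + e / e\<^sup>2) / 2 * h" for h e :: complex
      by (simp add: algebra_simps add_divide_distrib)
    moreover have "cis t / (cis t)\<^sup>2 = cis (- t)"
      by (simp add: power2_eq_square cis_inverse[symmetric] field_simps del: cis_inverse)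
    moreover have "(cis t + cis (- t)) / 2 = of_real (cos t)"
      by (simp add: complex_eq_iff)
    ultimately show ?thesis by metis
  qed
  have "((\<lambda>t. of_real (cos t) * H (cis t)) has_integral (- \<i> / 2 * (0 + 2 * pi * \<i> * d))) {0..2*pi}"
    using has_integral_mult_right[OF has_integral_add[OF 1 2], of "- \<i> / 2"] unfolding eq .
  from has_integral_linear[OF this bounded_linear_Re]
  have "((\<lambda>t. cos t * Re (H (cis t))) has_integral (pi * Re d)) {0..2*pi}"
    by (simp add: o_def)
  moreover have "continuous_on UNIV (\<lambda>t. cos t * Re (H (cis t)))"
    by (intro continuous_intros continuous_on_compose2[OF holomorphic_on_imp_continuous_on[OF H]])
      (use \<rho> in auto)
  ultimately show ?thesis
    by (simp add: circle_integral_eq integral_unique)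
qed

text \<open>Both functions are holomorphic near the closed disk, so only their derivatives at 0
  count. The reflected term vanishes there to order \<open>Suc m\<close>: it contributes for m = 0
  alone, and then independently of c.\<close>

lemma boundary_moments:
  assumes c: "norm c < 1"
  shows "(\<integral>t. cos t * Re (boundary_value m \<kappa> q c \<alpha> (cis t)) \<partial>lebesgue_on {0..2*pi})
      = pi * Re (of_nat (Suc m) * \<alpha> * (- c) ^ m + (if m = 0 then of_real (\<kappa> * q) * \<alpha> else 0))"
    and "(\<integral>t. cos t * Re (boundary_flux m \<kappa> q c \<alpha> (cis t)) \<partial>lebesgue_on {0..2*pi})
      = pi * Re (of_nat (Suc m) * \<alpha> * (- c) ^ m - (if m = 0 then of_real (\<kappa> * q) * \<alpha> else 0))"
proof -
  \<comment> \<open>A radius above 1 that stays below 1 / norm c, the modulus of the possible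
    pole.\<close>
  define \<rho> where "\<rho> = 2 / (1 + norm c)"
  have c1: "0 < 1 + norm c"
    by (simp add: add_pos_nonneg)
  have \<rho>: "\<rho> > 1"
    using c c1 by (simp add: \<rho>_def)
  have nz: "1 - cnj c * z \<noteq> 0" if "z \<in> ball 0 \<rho>" for z
  proof
    assume "1 - cnj c * z = 0"
    then have "norm (cnj c * z) = 1" by (metis eq_iff_diff_eq_0 norm_one)
    then have "norm c * norm z = 1" by (simp add: norm_mult)
    moreover have "norm c * norm z \<le> norm c * \<rho>"
      using that by (intro mult_left_mono) auto
    moreover have "norm c * \<rho> < 1"
      using c c1 by (simp add: \<rho>_def field_simps)
    ultimately show False by simp
  qed
  \<comment> \<open>With one factor z split off, the derivative at 0 is the value there of the other
    factor.\<close>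
  have G: "((\<lambda>z. z * G z) has_field_derivative G 0) (at 0)" if "G holomorphic_on ball 0 \<rho>" for G
  proof -
    have "(G has_field_derivative deriv G 0) (at 0)"
      using that \<rho> by (intro holomorphic_derivI[of _ "ball 0 \<rho>"]) auto
    from DERIV_mult[OF DERIV_ident this] show ?thesis by simp
  qed
  have hol: "(\<lambda>z. of_real (\<kappa> * q ^ Suc m) * \<alpha> * z ^ m / (1 - cnj c * z) ^ k) holomorphic_on ball 0 \<rho>" for k
    by (intro holomorphic_intros) (use nz in auto)
  have hol': "(\<lambda>z. z * (of_real (\<kappa> * q ^ Suc m) * \<alpha> * z ^ m / (1 - cnj c * z) ^ k)) holomorphic_on ball 0 \<rho>" for k
    by (intro holomorphic_intros hol)
  have bv: "boundary_value m \<kappa> q c \<alpha> = (\<lambda>z. \<alpha> * (z - c) ^ Suc m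
      + z * (of_real (\<kappa> * q ^ Suc m) * \<alpha> * z ^ m / (1 - cnj c * z) ^ Suc m))"
    by (simp add: boundary_value_def fun_eq_iff)
  have h1: "boundary_value m \<kappa> q c \<alpha> holomorphic_on ball 0 \<rho>"
    unfolding bv by (intro holomorphic_intros hol')
  have eq1: "of_nat (Suc m) * \<alpha> * (0 - c) ^ m + of_real (\<kappa> * q ^ Suc m) * \<alpha> * 0 ^ m / (1 - cnj c * 0) ^ Suc m
      = of_nat (Suc m) * \<alpha> * (- c) ^ m + (if m = 0 then of_real (\<kappa> * q) * \<alpha> else 0)"
    by (cases "m = 0") (simp_all del: of_nat_Suc)
  have d1: "(boundary_value m \<kappa> q c \<alpha> has_field_derivative
      of_nat (Suc m) * \<alpha> * (0 - c) ^ m + of_real (\<kappa> * q ^ Suc m) * \<alpha> * 0 ^ m / (1 - cnj c * 0) ^ Suc m) (at 0)"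
    unfolding bv by (intro DERIV_add DERIV_shifted_power G hol)
  show "(\<integral>t. cos t * Re (boundary_value m \<kappa> q c \<alpha> (cis t)) \<partial>lebesgue_on {0..2*pi})
      = pi * Re (of_nat (Suc m) * \<alpha> * (- c) ^ m + (if m = 0 then of_real (\<kappa> * q) * \<alpha> else 0))"
    by (rule cos_pairing[OF h1 \<rho> d1[unfolded eq1]])
  have bf: "boundary_flux m \<kappa> q c \<alpha> = (\<lambda>z. of_nat (Suc m) * (z * (\<alpha> * (z - c) ^ m)
      - z * (of_real (\<kappa> * q ^ Suc m) * \<alpha> * z ^ m / (1 - cnj c * z) ^ (m + 2))))"
    by (simp add: boundary_flux_def fun_eq_iff)
  have hol2: "(\<lambda>z. \<alpha> * (z - c) ^ m) holomorphic_on ball 0 \<rho>"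
    by (intro holomorphic_intros)
  have h2: "boundary_flux m \<kappa> q c \<alpha> holomorphic_on ball 0 \<rho>"
    unfolding bf by (intro holomorphic_intros hol' hol2)
  have eq2: "of_nat (Suc m) * (\<alpha> * (0 - c) ^ m - of_real (\<kappa> * q ^ Suc m) * \<alpha> * 0 ^ m / (1 - cnj c * 0) ^ (m + 2))
      = of_nat (Suc m) * \<alpha> * (- c) ^ m - (if m = 0 then of_real (\<kappa> * q) * \<alpha> else 0)"
    by (cases "m = 0") simp_all
  have d2: "(boundary_flux m \<kappa> q c \<alpha> has_field_derivative
      of_nat (Suc m) * (\<alpha> * (0 - c) ^ m - of_real (\<kappa> * q ^ Suc m) * \<alpha> * 0 ^ m / (1 - cnj c * 0) ^ (m + 2))) (at 0)"
    unfolding bf by (intro DERIV_cmult DERIV_diff G hol hol2)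
  show "(\<integral>t. cos t * Re (boundary_flux m \<kappa> q c \<alpha> (cis t)) \<partial>lebesgue_on {0..2*pi})
      = pi * Re (of_nat (Suc m) * \<alpha> * (- c) ^ m - (if m = 0 then of_real (\<kappa> * q) * \<alpha> else 0))"
    by (rule cos_pairing[OF h2 \<rho> d2[unfolded eq2]])
qed

text \<open>Both choices hidden in \<open>DtN\<close>, of the solution and of the extension of g,
  leave the energy unchanged, so any convenient pair may represent it.\<close>

lemma DtN_eq_energy:
  assumes "\<sigma>\<^sub>1 > 0" "\<sigma>\<^sub>2 > 0" "D \<in> sets borel"
    and u: "weak_solution \<sigma>\<^sub>1 \<sigma>\<^sub>2 D f u" and v: "has_trace v g"
  shows "the (DtN \<sigma>\<^sub>1 \<sigma>\<^sub>2 D f) g = energy \<sigma>\<^sub>1 \<sigma>\<^sub>2 D u v"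
proof -
  define u' where "u' = (SOME u. weak_solution \<sigma>\<^sub>1 \<sigma>\<^sub>2 D f u)"
  define v' where "v' = (SOME v. has_trace v g)"
  have u': "weak_solution \<sigma>\<^sub>1 \<sigma>\<^sub>2 D f u'"
    unfolding u'_def using someI[of "\<lambda>u. weak_solution \<sigma>\<^sub>1 \<sigma>\<^sub>2 D f u", OF u] by simp
  have v': "has_trace v' g"
    unfolding v'_def using someI[of "\<lambda>v. has_trace v g", OF v] by simp
  have "the (DtN \<sigma>\<^sub>1 \<sigma>\<^sub>2 D f) g = energy \<sigma>\<^sub>1 \<sigma>\<^sub>2 D u' v'"
    using u v by (auto simp: DtN_def conormal_derivative_def H_half_def u'_def v'_def)
  also have "\<dots> = energy \<sigma>\<^sub>1 \<sigma>\<^sub>2 D u v'"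
    using v' by (intro energy_weak_solution_unique[OF assms(3,1,2) u' u]) (simp add: has_trace_def)
  also have "\<dots> = energy \<sigma>\<^sub>1 \<sigma>\<^sub>2 D u v"
    by (rule energy_eq_of_trace_eq[OF assms(3) u v' v])
  finally show ?thesis .
qed

theorem theorem2p1:
  fixes \<sigma>\<^sub>1 \<sigma>\<^sub>2 R\<^sub>1 :: real and D\<^sub>1 D\<^sub>2 :: "complex set"
  assumes "\<sigma>\<^sub>1 > 0" and "\<sigma>\<^sub>2 > 0" and "\<sigma>\<^sub>1 \<noteq> \<sigma>\<^sub>2"
    and "0 < R\<^sub>1" and "R\<^sub>1 < 1" and "D\<^sub>1 = ball 0 R\<^sub>1"
    and "\<exists>c r. 0 < r \<and> D\<^sub>2 = ball c r"
    and "compact (closure D\<^sub>2)" and "closure D\<^sub>2 \<subseteq> \<Omega>"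
    and "DtN \<sigma>\<^sub>1 \<sigma>\<^sub>2 D\<^sub>1 (\<lambda>\<theta>. cos \<theta>) = DtN \<sigma>\<^sub>1 \<sigma>\<^sub>2 D\<^sub>2 (\<lambda>\<theta>. cos \<theta>)"
  shows "D\<^sub>1 = D\<^sub>2"
proof -
  obtain c r where r: "0 < r" and D2: "D\<^sub>2 = ball c r"
    using assms(7) by blast
  have cr: "norm c + r < 1"
    using assms(9) r by (simp add: D2 cball_subset_ball_iff)
  define \<kappa> where "\<kappa> = (\<sigma>\<^sub>1 - \<sigma>\<^sub>2) / (\<sigma>\<^sub>1 + \<sigma>\<^sub>2)"
  have \<kappa>: "\<kappa> * (\<sigma>\<^sub>1 + \<sigma>\<^sub>2) = \<sigma>\<^sub>1 - \<sigma>\<^sub>2" and \<kappa>0: "\<kappa> \<noteq> 0" and \<kappa>1: "\<bar>\<kappa>\<bar> < 1"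
    using assms(1-3) by (auto simp: \<kappa>_def abs_if field_simps)
  define q where "q = R\<^sub>1\<^sup>2"
  have q: "0 < q" "q < 1"
    using assms(4,5) by (auto simp: q_def power_less_one_iff abs_square_less_1)
  have pos: "1 + \<kappa> * q > 0"
  proof -
    have "\<bar>\<kappa> * q\<bar> < 1 * 1"
      unfolding abs_mult using \<kappa>1 q by (intro mult_strict_mono) auto
    then show ?thesis by linarith
  qed
  \<comment> \<open>For c = 0 and n = 1 the boundary value is
    \<open>(1 + \<kappa> * q) * \<alpha> * z\<close> and the flux is
    \<open>(1 - \<kappa> * q) * \<alpha> * z\<close>; \<mu> is their ratio, and \<open>a\<close>
    below normalizes the trace to cos.\<close>
  define \<mu> where "\<mu> = (1 - \<kappa> * q) / (1 + \<kappa> * q)"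
  have \<mu>1: "\<mu> \<noteq> 1"
    using pos \<kappa>0 q by (simp add: \<mu>_def field_simps)
  define a where "a = complex_of_real (1 / (1 + \<kappa> * q))"
  define u where "u = potential 0 \<kappa> q 0 a 0"
  have R: "norm (0::complex) + R\<^sub>1 < 1" using assms(5) by simp
  have "boundary_value 0 \<kappa> q 0 a z = z" for z
  proof -
    have "(1 + \<kappa> * q) * (1 / (1 + \<kappa> * q)) = 1"
      using pos by simp
    then have "of_real (1 + \<kappa> * q) * a = 1"
      unfolding a_def of_real_mult[symmetric] by (simp only: of_real_1)
    moreover have "boundary_value 0 \<kappa> q 0 a z = of_real (1 + \<kappa> * q) * a * z"
      by (simp add: boundary_value_def algebra_simps)
    ultimately show ?thesis by (simp only: mult_1)
  qed
  then have u_trace: "has_trace u (\<lambda>\<theta>. cos \<theta>)"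
    using potential_has_trace(1)[OF q(1), of 0 \<kappa> 0 a] potential_circle[OF assms(4) R, of "cis _" 0 \<kappa> a]
    by (simp add: u_def q_def)
  have flux: "(- \<i> * potential_grad 0 (- \<kappa>) q 0 (- \<i> * a) 0 (cis t)) \<bullet> cis t = \<mu> * cos t" for t
  proof -
    have "boundary_flux 0 \<kappa> q 0 a (cis t) = of_real \<mu> * cis t"
      by (simp add: boundary_flux_def a_def \<mu>_def algebra_simps diff_divide_distrib)
    then show ?thesis
      using flux_circle[OF assms(4) R, of "cis t" 0 \<kappa> a] by (simp add: q_def)
  qed
  have u_energy: "energy \<sigma>\<^sub>1 \<sigma>\<^sub>2 D\<^sub>1 u v = \<sigma>\<^sub>1 * (\<integral>t. g t * (\<mu> * cos t) \<partial>lebesgue_on {0..2*pi})"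
    if "has_trace v g" for v g
    using energy_potential[OF assms(4) \<kappa> that, of 0 0 a] unfolding q_def[symmetric] flux
    by (simp add: u_def assms(6))
  have u_sol: "weak_solution \<sigma>\<^sub>1 \<sigma>\<^sub>2 D\<^sub>1 (\<lambda>\<theta>. cos \<theta>) u"
    unfolding weak_solution_def
  proof (intro conjI ballI)
    show "u \<in> H1"
      using u_trace by (simp add: has_trace_def)
    fix v assume "v \<in> H1_0"
    then show "energy \<sigma>\<^sub>1 \<sigma>\<^sub>2 D\<^sub>1 u v = 0"
      using u_energy[of v "\<lambda>t. 0"] by (simp add: H1_0_def)
  qed (rule u_trace)
  have D_borel: "D\<^sub>1 \<in> sets borel" "D\<^sub>2 \<in> sets borel"
    by (auto simp: assms(6) D2)
  \<comment> \<open>Solvability for \<open>D\<^sub>2\<close> comes from the hypothesis: the explicit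
    \<open>u\<close> makes the left value of \<open>DtN\<close> defined, so the equal right value is
    defined too.\<close>
  have "DtN \<sigma>\<^sub>1 \<sigma>\<^sub>2 D\<^sub>2 (\<lambda>\<theta>. cos \<theta>) \<noteq> None"
    using u_sol assms(10)[symmetric] by (auto simp: DtN_def)
  then obtain u2 where u2: "weak_solution \<sigma>\<^sub>1 \<sigma>\<^sub>2 D\<^sub>2 (\<lambda>\<theta>. cos \<theta>) u2"
    by (auto simp: DtN_def split: if_splits)
  then have u2_trace: "has_trace u2 (\<lambda>\<theta>. cos \<theta>)"
    by (simp add: weak_solution_def)
  have key: "(\<integral>t. cos t * Re (boundary_flux m \<kappa> (r\<^sup>2) c \<alpha> (cis t)) \<partial>lebesgue_on {0..2*pi})
      = \<mu> * (\<integral>t. cos t * Re (boundary_value m \<kappa> (r\<^sup>2) c \<alpha> (cis t)) \<partial>lebesgue_on {0..2*pi})" for m \<alpha>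
  proof -
    define W where "W = potential m \<kappa> (r\<^sup>2) c \<alpha> 0"
    define g where "g t = W (cis t)" for t
    have W: "has_trace W g"
      using potential_has_trace(1)[of "r\<^sup>2"] r by (simp add: W_def g_def[abs_def])
    have g: "g t = Re (boundary_value m \<kappa> (r\<^sup>2) c \<alpha> (cis t))" for t
      unfolding g_def W_def by (rule potential_circle[OF r cr]) simp
    have "\<sigma>\<^sub>1 * (\<integral>t. cos t * Re (boundary_flux m \<kappa> (r\<^sup>2) c \<alpha> (cis t)) \<partial>lebesgue_on {0..2*pi})
        = energy \<sigma>\<^sub>1 \<sigma>\<^sub>2 D\<^sub>2 W u2"
      using energy_potential[OF r \<kappa> u2_trace, of c m \<alpha>] unfolding flux_circle[OF r cr norm_cis]
      by (simp add: D2 W_def)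
    \<comment> \<open>Symmetry exchanges the roles: the explicit W was the solution tested with u2,
      and now the unknown u2 is tested with W.\<close>
    also have "\<dots> = energy \<sigma>\<^sub>1 \<sigma>\<^sub>2 D\<^sub>2 u2 W"
      by (simp add: energy_def inner_commute)
    also have "\<dots> = the (DtN \<sigma>\<^sub>1 \<sigma>\<^sub>2 D\<^sub>2 (\<lambda>\<theta>. cos \<theta>)) g"
      using DtN_eq_energy[OF assms(1,2) D_borel(2) u2 W] by simp
    \<comment> \<open>W solves the equation for \<open>D\<^sub>2\<close>; for
      \<open>D\<^sub>1\<close> it serves merely as an extension of its trace g.\<close>
    also have "\<dots> = energy \<sigma>\<^sub>1 \<sigma>\<^sub>2 D\<^sub>1 u W"
      using DtN_eq_energy[OF assms(1,2) D_borel(1) u_sol W] assms(10) by simp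
    also have "\<dots> = \<sigma>\<^sub>1 * (\<integral>t. \<mu> * (cos t * g t) \<partial>lebesgue_on {0..2*pi})"
      unfolding u_energy[OF W] by (simp add: mult_ac)
    finally show ?thesis
      using assms(1) unfolding g by simp
  qed
  have c1: "norm c < 1" using cr r by simp
  \<comment> \<open>For n = 1 and \<alpha> = 1 the two moments are pi times
    \<open>1 - \<kappa> * r\<^sup>2\<close> and \<open>1 + \<kappa> * r\<^sup>2\<close>.\<close>
  have "1 - \<kappa> * r\<^sup>2 = \<mu> * (1 + \<kappa> * r\<^sup>2)"
    using key[of 0 1] unfolding boundary_moments[OF c1] by simp
  then have "(1 - \<kappa> * r\<^sup>2) * (1 + \<kappa> * q) = (1 - \<kappa> * q) * (1 + \<kappa> * r\<^sup>2)"
    using pos by (simp add: \<mu>_def field_simps)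
  then have "\<kappa> * r\<^sup>2 = \<kappa> * q"
    by (auto simp: algebra_simps)
  then have "r = R\<^sub>1"
    using \<kappa>0 r assms(4) by (simp add: q_def)
  moreover have "c = 0"
  proof -
    \<comment> \<open>For n = 2 the flux and the boundary value have the same moment, - 2 pi
      \<open>Re (\<alpha> * c)\<close>, so \<open>\<mu> \<noteq> 1\<close> forces it to vanish. The
      values 1 and \<i> of \<alpha> then give both coordinates of c.\<close>
    have "Re (\<alpha> * c) = \<mu> * Re (\<alpha> * c)" for \<alpha>
      using key[of 1 \<alpha>] unfolding boundary_moments[OF c1] by auto
    then have "Re (\<alpha> * c) = 0" for \<alpha>
      using \<mu>1 by (metis mult_cancel_right1)
    from this[of 1] this[of \<i>] show ?thesis
      by (simp add: complex_eq_iff)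
  qed
  ultimately show ?thesis
    by (simp add: assms(6) D2)
qed

end
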